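(* For every integer $\Delta\ge 2$, there exists a graph $G$ with maximum degree $\Delta(G)=\Delta$ and $\omega(G)=\chi(G)=\left\lceil\frac23(\Delta+1)\right\rceil-1$ such that $\operatorname{vs}_\chi(G)=\operatorname{vs}_\omega(G)<\operatorname{ivs}_\omega(G)=\operatorname{ivs}_\chi(G)$.
   Context: For a graph $G$, $\Delta(G)$, $\chi(G)$ and $\omega(G)$ denote the maximum degree, chromatic number and clique number of $G$. The chromatic vertex stability number $\operatorname{vs}_\chi(G)$ (respectively the clique vertex stability number $\operatorname{vs}_\omega(G)$) is the minimum size of a set $S\subseteq V(G)$ such that $\chi(G\setminus S)<\chi(G)$ (respectively $\omega(G\setminus S)<\omega(G)$). The independent versions $\operatorname{ivs}_\chi(G)$ and $\operatorname{ivs}_\omega(G)$ are the minimum sizes of an independent set $S\subseteq V(G)$ with $\chi(G\setminus S)<\chi(G)$, respectively $\omega(G\setminus S)<\omega(G)$. In general $\operatorname{ivs}_\omega(G)$ might not exist, but it does whenever $\omega(G)=\chi(G)$.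
   Formalization: The claim is stated for Δ ≥ 3 instead of Δ ≥ 2: for Δ = 2 the formula gives ω(G) = 1, while a graph of maximum degree 2 has an edge and so ω(G) ≥ 2, so no such graph exists. *)

theory Defs
  imports Complex_Main "Graph_Theory.Graph_Theory"
begin

text \<open>
  Finite simple graphs are the loop-free symmetric digraphs without parallel arcs of the
  locale \<^locale>\<open>graph\<close>: an edge \<open>uv\<close> is the pair of arcs \<open>u\<close> to \<open>v\<close> and \<open>v\<close> to \<open>u\<close>, so the degree of a
  vertex is its out-degree. The constants below are only meant for such graphs.
\<close>

text \<open>The \<open>insert 0\<close> only serves to give the null graph maximum degree 0.\<close>
definition max_degree :: "('a, 'b) pre_digraph \<Rightarrow> nat" where
  "max_degree G = Max (insert 0 (out_degree G ` verts G))"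

definition proper_colouring :: "('a, 'b) pre_digraph \<Rightarrow> nat \<Rightarrow> ('a \<Rightarrow> nat) \<Rightarrow> bool" where
  "proper_colouring G k c \<longleftrightarrow>
     (\<forall>v \<in> verts G. c v < k) \<and> (\<forall>u v. u \<rightarrow>\<^bsub>G\<^esub> v \<longrightarrow> c u \<noteq> c v)"

definition chromatic_number :: "('a, 'b) pre_digraph \<Rightarrow> nat" where
  "chromatic_number G = (LEAST k. \<exists>c. proper_colouring G k c)"

definition is_clique :: "('a, 'b) pre_digraph \<Rightarrow> 'a set \<Rightarrow> bool" where
  "is_clique G K \<longleftrightarrow> K \<subseteq> verts G \<and> (\<forall>u \<in> K. \<forall>v \<in> K. u \<noteq> v \<longrightarrow> u \<rightarrow>\<^bsub>G\<^esub> v)"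

definition clique_number :: "('a, 'b) pre_digraph \<Rightarrow> nat" where
  "clique_number G = Max {card K | K. is_clique G K}"

definition is_independent :: "('a, 'b) pre_digraph \<Rightarrow> 'a set \<Rightarrow> bool" where
  "is_independent G S \<longleftrightarrow> S \<subseteq> verts G \<and> (\<forall>u \<in> S. \<forall>v \<in> S. \<not> u \<rightarrow>\<^bsub>G\<^esub> v)"

definition remove_verts :: "('a, 'b) pre_digraph \<Rightarrow> 'a set \<Rightarrow> ('a, 'b) pre_digraph" where
  "remove_verts G S = G \<restriction> (verts G - S)"

text \<open>
  The four stability numbers are minima over sets of natural numbers, and \<open>LEAST\<close> is unspecified
  when no admissible set \<open>S\<close> exists. For a non-null finite graph this can only happen for
  \<open>ivs_clique\<close>, and not even there if the clique number equals the chromatic number: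
  a colour class of an optimal colouring then meets every maximum clique
  (lemma \<open>ivs_clique_witness\<close> below).
\<close>
definition vs_chromatic :: "('a, 'b) pre_digraph \<Rightarrow> nat" where
  "vs_chromatic G = (LEAST n. \<exists>S \<subseteq> verts G. card S = n \<and>
     chromatic_number (remove_verts G S) < chromatic_number G)"

definition vs_clique :: "('a, 'b) pre_digraph \<Rightarrow> nat" where
  "vs_clique G = (LEAST n. \<exists>S \<subseteq> verts G. card S = n \<and>
     clique_number (remove_verts G S) < clique_number G)"

definition ivs_chromatic :: "('a, 'b) pre_digraph \<Rightarrow> nat" where
  "ivs_chromatic G = (LEAST n. \<exists>S. is_independent G S \<and> card S = n \<and>
     chromatic_number (remove_verts G S) < chromatic_number G)"

definition ivs_clique :: "('a, 'b) pre_digraph \<Rightarrow> nat" where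
  "ivs_clique G = (LEAST n. \<exists>S. is_independent G S \<and> card S = n \<and>
     clique_number (remove_verts G S) < clique_number G)"


lemma (in graph) finite_clique_cards: "finite {card K | K. is_clique G K}"
proof -
  have "{card K | K. is_clique G K} \<subseteq> card ` Pow (verts G)"
    by (auto simp: is_clique_def)
  then show ?thesis
    by (rule finite_subset) simp
qed

lemma (in graph) card_clique_le:
  assumes "is_clique G K"
  shows "card K \<le> clique_number G"
  unfolding clique_number_def using assms by (intro Max_ge[OF finite_clique_cards]) auto

lemma (in graph) obtain_maximum_clique:
  obtains K where "is_clique G K" "card K = clique_number G"
proof -
  have "is_clique G {}"
    by (simp add: is_clique_def)
  then have "clique_number G \<in> {card K | K. is_clique G K}"
    unfolding clique_number_def by (intro Max_in finite_clique_cards) auto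
  then show ?thesis
    using that by auto
qed

lemma (in graph) graph_remove_verts: "graph (remove_verts G S)"
proof -
  have "sym (arcs_ends (G \<restriction> (verts G - S)))"
  proof (rule symI)
    fix u v
    assume "u \<rightarrow>\<^bsub>G \<restriction> (verts G - S)\<^esub> v"
    then have uv: "u \<rightarrow> v" "u \<in> verts G - S" "v \<in> verts G - S"
      by (auto simp: arcs_ends_conv)
    from uv(1) have "v \<rightarrow> u"
      by (rule arcs_ends_symmetric[OF sym_arcs])
    then show "v \<rightarrow>\<^bsub>G \<restriction> (verts G - S)\<^esub> u"
      using uv by (auto simp: arcs_ends_conv)
  qed
  moreover have "fin_digraph (G \<restriction> (verts G - S))"
    by (rule fin_digraph.intro) (auto simp: fin_digraph_axioms_def)
  moreover have "loopfree_digraph_axioms (G \<restriction> (verts G - S))"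
    by (simp add: loopfree_digraph_axioms_def no_loops)
  moreover have "nomulti_digraph_axioms (G \<restriction> (verts G - S))"
    by (simp add: nomulti_digraph_axioms_def no_multi_arcs)
  ultimately show ?thesis
    unfolding remove_verts_def symmetric_def[symmetric]
    by (simp add: graph_def digraph_def pseudo_graph_def loopfree_digraph_def nomulti_digraph_def
        sym_digraph_def sym_digraph_axioms_def fin_digraph_def)
qed

lemma (in graph) obtain_optimal_colouring:
  obtains c where "proper_colouring G (chromatic_number G) c"
proof -
  obtain c where c: "bij_betw c (verts G) {0..<card (verts G)}"
    using ex_bij_betw_finite_nat[OF finite_verts] by blast
  have "c u \<noteq> c v" if "u \<rightarrow> v" for u v
  proof -
    have "u \<in> verts G" "v \<in> verts G" "u \<noteq> v"
      using that adj_in_verts adj_not_same by blast+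
    then show ?thesis
      using c by (auto simp: bij_betw_def inj_on_def)
  qed
  then have "proper_colouring G (card (verts G)) c"
    using c by (auto simp: proper_colouring_def bij_betw_def)
  then have "\<exists>c. proper_colouring G (card (verts G)) c"
    by blast
  then have "\<exists>c. proper_colouring G (chromatic_number G) c"
    unfolding chromatic_number_def by (rule LeastI)
  then show ?thesis
    using that by blast
qed

lemma (in graph) ivs_clique_witness:
  assumes "clique_number G = chromatic_number G" "verts G \<noteq> {}"
  shows "\<exists>S. is_independent G S \<and> clique_number (remove_verts G S) < clique_number G"
proof -
  let ?k = "chromatic_number G"
  obtain c where c: "proper_colouring G ?k c"
    using obtain_optimal_colouring by blast
  have "?k > 0"
    using c assms(2) by (auto simp: proper_colouring_def)
  define S where "S = {v \<in> verts G. c v = 0}"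
  interpret R: graph "remove_verts G S"
    by (rule graph_remove_verts)
  obtain K where K: "is_clique (remove_verts G S) K" "card K = clique_number (remove_verts G S)"
    using R.obtain_maximum_clique by blast
  have KV: "K \<subseteq> verts G - S"
    using K(1) by (auto simp: is_clique_def remove_verts_def)
  have "inj_on c K"
  proof (rule inj_onI, rule ccontr)
    fix u v
    assume "u \<in> K" "v \<in> K" "c u = c v" "u \<noteq> v"
    then have "u \<rightarrow> v"
      using K(1) dominates_induce_subgraphD unfolding is_clique_def remove_verts_def by metis
    then show False
      using c \<open>c u = c v\<close> by (auto simp: proper_colouring_def)
  qed
  moreover have "c ` K \<subseteq> {1..<?k}"
    using KV c by (force simp: S_def proper_colouring_def)
  ultimately have "card K \<le> card {1..<?k}"
    using card_inj_on_le by blast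
  then have "clique_number (remove_verts G S) < clique_number G"
    using K(2) \<open>?k > 0\<close> assms(1) by simp
  moreover have "is_independent G S"
    using c unfolding is_independent_def S_def proper_colouring_def by fastforce
  ultimately show ?thesis
    by blast
qed

lemma (in graph) clique_number_ge_2:
  assumes "max_degree G > 0"
  shows "clique_number G \<ge> 2"
proof -
  have "max_degree G \<in> insert 0 (out_degree G ` verts G)"
    unfolding max_degree_def by (rule Max_in) auto
  then obtain u where "out_degree G u > 0"
    using assms by auto
  then obtain e where e: "e \<in> arcs G" "tail G e = u"
    by (fastforce simp: out_degree_def card_gt_0_iff)
  let ?v = "head G e"
  have "u \<rightarrow> ?v" "u \<noteq> ?v"
    using e no_loops by (auto simp: arcs_ends_conv)
  moreover from this have "?v \<rightarrow> u"
    by (blast intro: arcs_ends_symmetric[OF sym_arcs])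
  ultimately have "is_clique G {u, ?v}"
    using adj_in_verts by (auto simp: is_clique_def)
  from card_clique_le[OF this] show ?thesis
    using \<open>u \<noteq> ?v\<close> by simp
qed

text \<open>
  For \<open>\<Delta> = 2\<close> the formula \<open>\<lceil>2/3 (\<Delta> + 1)\<rceil> - 1\<close> has the value 1, but a graph of maximum degree 2 has
  an edge and hence clique number at least 2. This is why the theorem about this formula is only
  stated for \<open>\<Delta> \<ge> 3\<close>.
\<close>
lemma no_graph_of_max_degree_2:
  "\<not> (\<exists>G :: ('a, 'b) pre_digraph. graph G \<and> max_degree G = 2 \<and>
        int (clique_number G) = \<lceil>2 / 3 * (real 2 + 1)\<rceil> - 1)"
proof
  assume "\<exists>G :: ('a, 'b) pre_digraph. graph G \<and> max_degree G = 2 \<and>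
        int (clique_number G) = \<lceil>2 / 3 * (real 2 + 1)\<rceil> - 1"
  then obtain G :: "('a, 'b) pre_digraph" where
    "graph G" "max_degree G = 2" "int (clique_number G) = 1"
    by auto
  then show False
    using graph.clique_number_ge_2[of G] by simp
qed

end

theory Submission
  imports Defs
begin

text \<open>
  Let \<open>m = \<Delta> div 3\<close>. The required clique number is \<open>k = 2m\<close> if \<open>3\<close> divides \<open>\<Delta>\<close> and \<open>k = 2m + 1\<close>
  otherwise. The graph is designed so that hitting all \<open>k\<close>-cliques with as few vertices as possible,
  say \<open>t\<close>, amounts to choosing one vertex from each of \<open>t\<close> disjoint sets, and extra edges between
  these sets make an independent choice impossible. This is the problem of independent
  transversals: sets of size at least \<open>2d\<close> in a graph of maximum degree \<open>d\<close> always have one, but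
  sets of size \<open>2d - 1\<close> need not.

  The building block is \<open>K\<^bsub>k+1\<^esub>\<close> without an edge. It has two \<open>k\<close>-cliques, which share \<open>k - 1\<close>
  vertices, so a single vertex that meets both is one of these. A cluster generalises this: it is a
  graph whose \<open>k\<close>-cliques need \<open>t\<close> vertices to be met, together with a set \<open>L\<close> of exits such that
  every independent set that meets them with exactly \<open>t\<close> vertices uses an exit. If all edges between
  sets \<open>A\<close> and \<open>B\<close> of exits of two clusters are added, an optimal independent set of the union
  cannot use both \<open>A\<close> and \<open>B\<close>, and so the exits outside \<open>A \<union> B\<close> are enough
  (lemma \<open>cluster_join\<close>). Joining \<open>m\<close> exits of one cluster with \<open>m\<close> exits of a second one,
  if both have \<open>l\<close> exits, leaves \<open>2(l - m)\<close>. If one starts with \<open>l = 2m - 1\<close>, this number decreases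
  until it is at most \<open>m\<close>; then all exits are joined and none remains, so that no
  independent set of size \<open>t\<close> meets all \<open>k\<close>-cliques (lemma \<open>assembly_gap\<close>). Every exit takes part in
  at most one join, which keeps the degrees at most \<open>\<Delta>\<close>.

  For \<open>k = 2m\<close> the building block itself has \<open>2m - 1\<close> exits, of degree \<open>2m = \<Delta> - m\<close>. For \<open>k = 2m + 1\<close> it
  has \<open>2m\<close> exits, one too many, but a complete graph \<open>K\<^bsub>2m+1\<^esub>\<close> joined to two building blocks
  yields \<open>2m - 1\<close> exits (lemma \<open>assembly_odd\<close>).

  The upper bounds come from \<open>k\<close>-colourings, whose colour \<open>0\<close> is the one to be removed. Two kinds
  are maintained: colourings with \<open>t\<close> vertices of colour \<open>0\<close>, exactly one of which is an exit, and this
  may be any prescribed exit; and a colouring with \<open>t + 1\<close> vertices of colour \<open>0\<close>, none of which is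
  an exit. Colourings of two clusters fit together after a permutation of the nonzero colours, since
  \<open>A\<close> and \<open>B\<close> together have at most \<open>k\<close> vertices. In the last join, the second kind survives and
  gives an independent set of size \<open>t + 1\<close> whose removal leaves a \<open>(k - 1)\<close>-colourable graph; two
  colourings of the first kind give such a set of size \<open>t\<close> with a single edge inside.
\<close>

section \<open>Graphs given by an edge relation\<close>

definition simple_on :: "nat set \<Rightarrow> (nat \<times> nat) set \<Rightarrow> bool" where
  "simple_on V E \<longleftrightarrow> finite V \<and> E \<subseteq> V \<times> V \<and> sym E \<and> irrefl E"

definition rel_graph :: "nat set \<Rightarrow> (nat \<times> nat) set \<Rightarrow> (nat, nat \<times> nat) pre_digraph" where
  "rel_graph V E = \<lparr>verts = V, arcs = E, tail = fst, head = snd\<rparr>"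

lemma verts_rel_graph [simp]: "verts (rel_graph V E) = V"
  by (simp add: rel_graph_def)

lemma dominates_rel_graph [simp]: "u \<rightarrow>\<^bsub>rel_graph V E\<^esub> v \<longleftrightarrow> (u, v) \<in> E"
  by (auto simp: rel_graph_def arcs_ends_def arc_to_ends_def image_iff)

lemma graph_rel_graph:
  assumes "simple_on V E"
  shows "graph (rel_graph V E)"
proof -
  have "finite E"
    using assms by (auto simp: simple_on_def intro: finite_subset)
  moreover have "sym (arcs_ends (rel_graph V E))"
    using assms by (auto simp: simple_on_def sym_def)
  ultimately show ?thesis
    using assms
    by unfold_locales (auto simp: simple_on_def rel_graph_def irrefl_def arc_to_ends_def symmetric_def)
qed

lemma out_degree_rel_graph: "out_degree (rel_graph V E) v = card (E `` {v})"
proof -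
  have "out_arcs (rel_graph V E) v = Pair v ` (E `` {v})"
    by (auto simp: out_arcs_def rel_graph_def)
  then show ?thesis
    by (simp add: out_degree_def card_image inj_on_def)
qed

definition meets_cliques :: "nat \<Rightarrow> (nat, nat \<times> nat) pre_digraph \<Rightarrow> nat set \<Rightarrow> bool" where
  "meets_cliques k G S \<longleftrightarrow> (\<forall>K. is_clique G K \<longrightarrow> card K = k \<longrightarrow> S \<inter> K \<noteq> {})"

section \<open>Joins\<close>

definition join :: "(nat \<times> nat) set \<Rightarrow> (nat \<times> nat) set \<Rightarrow> nat set \<Rightarrow> nat set \<Rightarrow> (nat \<times> nat) set" where
  "join E1 E2 A B = E1 \<union> E2 \<union> A \<times> B \<union> B \<times> A"

lemma simple_on_join:
  assumes "simple_on V1 E1" "simple_on V2 E2" "V1 \<inter> V2 = {}" "A \<subseteq> V1" "B \<subseteq> V2"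
  shows "simple_on (V1 \<union> V2) (join E1 E2 A B)"
  using assms unfolding simple_on_def join_def irrefl_def sym_def by blast

lemma degree_join:
  assumes "simple_on V1 E1" "simple_on V2 E2" "V1 \<inter> V2 = {}" "A \<subseteq> V1" "B \<subseteq> V2"
  shows "v \<in> V1 \<Longrightarrow> card (join E1 E2 A B `` {v}) \<le> card (E1 `` {v}) + (if v \<in> A then card B else 0)"
    and "v \<in> V2 \<Longrightarrow> card (join E1 E2 A B `` {v}) \<le> card (E2 `` {v}) + (if v \<in> B then card A else 0)"
proof -
  assume "v \<in> V1"
  then have "join E1 E2 A B `` {v} = E1 `` {v} \<union> (if v \<in> A then B else {})"
    using assms by (auto simp: join_def simple_on_def)
  then show "card (join E1 E2 A B `` {v}) \<le> card (E1 `` {v}) + (if v \<in> A then card B else 0)"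
    using card_Un_le[of "E1 `` {v}" B] by auto
next
  assume "v \<in> V2"
  then have "join E1 E2 A B `` {v} = E2 `` {v} \<union> (if v \<in> B then A else {})"
    using assms by (auto simp: join_def simple_on_def)
  then show "card (join E1 E2 A B `` {v}) \<le> card (E2 `` {v}) + (if v \<in> B then card A else 0)"
    using card_Un_le[of "E2 `` {v}" A] by auto
qed

lemma meets_cliques_join:
  assumes "meets_cliques k (rel_graph (V1 \<union> V2) (join E1 E2 A B)) S"
  shows "meets_cliques k (rel_graph V1 E1) (S \<inter> V1)" "meets_cliques k (rel_graph V2 E2) (S \<inter> V2)"
proof -
  have up: "is_clique (rel_graph (V1 \<union> V2) (join E1 E2 A B)) K"
    if "is_clique (rel_graph V1 E1) K \<or> is_clique (rel_graph V2 E2) K" for K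
    using that by (auto simp: is_clique_def join_def)
  have sub: "K \<subseteq> V" if "is_clique (rel_graph V E) K" for V E K
    using that by (simp add: is_clique_def)
  show "meets_cliques k (rel_graph V1 E1) (S \<inter> V1)"
    using assms up sub[of V1 E1] unfolding meets_cliques_def by blast
  show "meets_cliques k (rel_graph V2 E2) (S \<inter> V2)"
    using assms up sub[of V2 E2] unfolding meets_cliques_def by blast
qed

lemma is_independent_join:
  assumes "is_independent (rel_graph (V1 \<union> V2) (join E1 E2 A B)) S"
  shows "is_independent (rel_graph V1 E1) (S \<inter> V1)" "is_independent (rel_graph V2 E2) (S \<inter> V2)"
    and "S \<inter> A = {} \<or> S \<inter> B = {}"
  using assms by (auto simp: is_independent_def join_def)

definition cliques_need :: "nat \<Rightarrow> nat set \<Rightarrow> (nat \<times> nat) set \<Rightarrow> nat \<Rightarrow> bool" where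
  "cliques_need k V E t \<longleftrightarrow> (\<forall>S \<subseteq> V. meets_cliques k (rel_graph V E) S \<longrightarrow> t \<le> card S)"

lemma card_split:
  assumes "S \<subseteq> V1 \<union> V2" "V1 \<inter> V2 = {}" "finite V1" "finite V2"
  shows "card S = card (S \<inter> V1) + card (S \<inter> V2)"
proof -
  have "card ((S \<inter> V1) \<union> (S \<inter> V2)) = card (S \<inter> V1) + card (S \<inter> V2)"
    using assms by (intro card_Un_disjoint) auto
  moreover have "(S \<inter> V1) \<union> (S \<inter> V2) = S"
    using assms by auto
  ultimately show ?thesis
    by simp
qed

lemma cliques_need_join:
  assumes "cliques_need k V1 E1 t1" "cliques_need k V2 E2 t2" "V1 \<inter> V2 = {}" "finite V1" "finite V2"
  shows "cliques_need k (V1 \<union> V2) (join E1 E2 A B) (t1 + t2)"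
  unfolding cliques_need_def
proof (intro allI impI)
  fix S
  assume S: "S \<subseteq> V1 \<union> V2" "meets_cliques k (rel_graph (V1 \<union> V2) (join E1 E2 A B)) S"
  then have "t1 \<le> card (S \<inter> V1)" "t2 \<le> card (S \<inter> V2)"
    using assms(1,2) meets_cliques_join[OF S(2)] by (auto simp: cliques_need_def)
  then show "t1 + t2 \<le> card S"
    using card_split[OF S(1) assms(3-5)] by linarith
qed

text \<open>
  Here \<open>t\<close> is the bound of \<open>cliques_need\<close>, so the independent sets in question are optimal. For
  \<open>L = {}\<close> the definition says that no independent set is optimal.
\<close>
definition forced :: "nat \<Rightarrow> nat set \<Rightarrow> (nat \<times> nat) set \<Rightarrow> nat set \<Rightarrow> nat \<Rightarrow> bool" where
  "forced k V E L t \<longleftrightarrow> (\<forall>S. is_independent (rel_graph V E) S \<longrightarrow>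
     meets_cliques k (rel_graph V E) S \<longrightarrow> card S = t \<longrightarrow> S \<inter> L \<noteq> {})"

text \<open>The two lower bounds add up, so an optimal set of the join is optimal on both sides.\<close>
lemma join_tight_parts:
  assumes "cliques_need k V1 E1 t1" "cliques_need k V2 E2 t2" "V1 \<inter> V2 = {}" "finite V1" "finite V2"
    and S: "is_independent (rel_graph (V1 \<union> V2) (join E1 E2 A B)) S"
      "meets_cliques k (rel_graph (V1 \<union> V2) (join E1 E2 A B)) S" "card S = t1 + t2"
  shows "card (S \<inter> V1) = t1" "card (S \<inter> V2) = t2"
proof -
  have "S \<subseteq> V1 \<union> V2"
    using S(1) by (simp add: is_independent_def)
  then have "card S = card (S \<inter> V1) + card (S \<inter> V2)"
    using card_split assms(3-5) by blast
  moreover have "t1 \<le> card (S \<inter> V1)" "t2 \<le> card (S \<inter> V2)"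
    using assms(1,2) meets_cliques_join[OF S(2)] by (auto simp: cliques_need_def)
  ultimately show "card (S \<inter> V1) = t1" "card (S \<inter> V2) = t2"
    using S(3) by linarith+
qed

text \<open>
  An optimal set contains an exit on either side. Being independent it avoids \<open>A\<close> or \<open>B\<close>, and the
  exit on that side survives.
\<close>
lemma forced_join:
  assumes "cliques_need k V1 E1 t1" "cliques_need k V2 E2 t2" "V1 \<inter> V2 = {}" "finite V1" "finite V2"
    and "forced k V1 E1 L1 t1" "forced k V2 E2 L2 t2"
  shows "forced k (V1 \<union> V2) (join E1 E2 A B) ((L1 - A) \<union> (L2 - B)) (t1 + t2)"
  unfolding forced_def
proof (intro allI impI)
  fix S
  assume S: "is_independent (rel_graph (V1 \<union> V2) (join E1 E2 A B)) S"
    "meets_cliques k (rel_graph (V1 \<union> V2) (join E1 E2 A B)) S" "card S = t1 + t2"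
  note tight = join_tight_parts[OF assms(1-5) S]
  have "S \<inter> V1 \<inter> L1 \<noteq> {}"
    using assms(6) is_independent_join(1)[OF S(1)] meets_cliques_join(1)[OF S(2)] tight(1)
    unfolding forced_def by blast
  moreover have "S \<inter> V2 \<inter> L2 \<noteq> {}"
    using assms(7) is_independent_join(2)[OF S(1)] meets_cliques_join(2)[OF S(2)] tight(2)
    unfolding forced_def by blast
  ultimately show "S \<inter> ((L1 - A) \<union> (L2 - B)) \<noteq> {}"
    using is_independent_join(3)[OF S(1)] by blast
qed

section \<open>Colourings\<close>

lemma ex_permutation_disjoint:
  assumes "finite D" "X \<subseteq> D" "Y \<subseteq> D" "card X + card Y \<le> card D"
  shows "\<exists>p. bij_betw p D D \<and> p ` Y \<inter> X = {}"
proof -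
  have fin: "finite X" "finite Y"
    using assms finite_subset by auto
  have "card Y \<le> card (D - X)"
    using assms fin by (simp add: card_Diff_subset)
  then obtain Z where Z: "Z \<subseteq> D - X" "card Z = card Y"
    using obtain_subset_with_card_n by metis
  then have "finite Z" "Z \<subseteq> D"
    using assms(1) finite_subset by auto
  then obtain f where f: "bij_betw f Y Z"
    using finite_same_card_bij[OF fin(2)] Z(2) by metis
  have "card (D - Y) = card (D - Z)"
    using \<open>Z \<subseteq> D\<close> assms(3) Z(2) fin \<open>finite Z\<close> by (simp add: card_Diff_subset)
  then obtain g where g: "bij_betw g (D - Y) (D - Z)"
    using finite_same_card_bij[of "D - Y" "D - Z"] assms(1) by auto
  let ?p = "\<lambda>x. if x \<in> Y then f x else g x"
  have "bij_betw ?p (Y \<union> (D - Y)) (Z \<union> (D - Z))"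
    using f g by (intro bij_betw_disjoint_Un) auto
  moreover have "Y \<union> (D - Y) = D" "Z \<union> (D - Z) = D"
    using assms(3) \<open>Z \<subseteq> D\<close> by auto
  moreover have "?p ` Y = Z"
    using f by (auto simp: bij_betw_def)
  ultimately show ?thesis
    using Z(1) by (metis Diff_disjoint Int_commute disjoint_iff subsetD)
qed

text \<open>
  The colouring of the second graph is permuted so that \<open>A\<close> and \<open>B\<close> share no nonzero colour. There is
  room for this among the \<open>k - 1\<close> nonzero colours because at least one vertex of \<open>A\<close> or \<open>B\<close> has
  colour \<open>0\<close>. The colour classes of \<open>0\<close> are kept, so edges between them are the only conflicts.
\<close>
lemma glue_colourings:
  assumes c: "proper_colouring (rel_graph V1 E1) k c1" "proper_colouring (rel_graph V2 E2) k c2"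
    and V: "simple_on V1 E1" "simple_on V2 E2" "V1 \<inter> V2 = {}" "A \<subseteq> V1" "B \<subseteq> V2"
    and AB: "card A + card B \<le> k" and zero: "0 \<in> c1 ` A \<or> 0 \<in> c2 ` B"
  shows "\<exists>c. (\<forall>v \<in> V1. c v = 0 \<longleftrightarrow> c1 v = 0) \<and> (\<forall>v \<in> V2. c v = 0 \<longleftrightarrow> c2 v = 0) \<and>
    (\<forall>v \<in> V1 \<union> V2. c v < k) \<and>
    (\<forall>u v. (u, v) \<in> join E1 E2 A B \<longrightarrow> c u = c v \<longrightarrow>
        c u = 0 \<and> (u \<in> A \<and> v \<in> B \<or> u \<in> B \<and> v \<in> A))"
proof -
  let ?X = "c1 ` A - {0}" and ?Y = "c2 ` B - {0}"
  have fin: "finite A" "finite B"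
    using V finite_subset unfolding simple_on_def by blast+
  have cX: "card ?X \<le> card A"
    by (rule order_trans[OF card_mono[OF _ Diff_subset] card_image_le]) (simp_all add: fin)
  have cX0: "card ?X < card A" if "0 \<in> c1 ` A"
    by (rule less_le_trans[OF card_Diff1_less[OF _ that] card_image_le]) (simp_all add: fin)
  have cY: "card ?Y \<le> card B"
    by (rule order_trans[OF card_mono[OF _ Diff_subset] card_image_le]) (simp_all add: fin)
  have cY0: "card ?Y < card B" if "0 \<in> c2 ` B"
    by (rule less_le_trans[OF card_Diff1_less[OF _ that] card_image_le]) (simp_all add: fin)
  have "card ?X + card ?Y < card A + card B"
    using zero
  proof
    assume "0 \<in> c1 ` A"
    then show ?thesis
      using cX0 cY by linarith
  next
    assume "0 \<in> c2 ` B"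
    then show ?thesis
      using cX cY0 by linarith
  qed
  then have "card ?X + card ?Y \<le> card {1..<k}"
    using AB by simp
  moreover have "?X \<subseteq> {1..<k}" "?Y \<subseteq> {1..<k}"
    using c V by (auto simp: proper_colouring_def Suc_le_eq)
  ultimately obtain p where p: "bij_betw p {1..<k} {1..<k}" "p ` ?Y \<inter> ?X = {}"
    using ex_permutation_disjoint[of "{1..<k}" ?X ?Y] by auto
  define c where "c v = (if v \<in> V1 then c1 v else if c2 v = 0 then 0 else p (c2 v))" for v
  have pD: "p i \<in> {1..<k}" if "i \<noteq> 0" "i < k" for i
    using that p(1) by (auto simp: bij_betw_def)
  have p_inj: "p i \<noteq> p j" if "i \<noteq> j" "i \<noteq> 0" "i < k" "j \<noteq> 0" "j < k" for i j
    using that p(1) by (auto simp: bij_betw_def inj_on_def)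
  have lt: "c1 v < k" if "v \<in> V1" for v
    using c(1) that by (simp add: proper_colouring_def)
  have lt2: "c2 v < k" if "v \<in> V2" for v
    using c(2) that by (simp add: proper_colouring_def)
  have c2_eq: "c v = (if c2 v = 0 then 0 else p (c2 v))" if "v \<in> V2" for v
    using that V(3) by (auto simp: c_def)
  have z2: "c v = 0 \<longleftrightarrow> c2 v = 0" if "v \<in> V2" for v
    using c2_eq[OF that] pD[of "c2 v"] lt2[OF that] by auto
  have cross: "c u = 0" if "u \<in> A" "v \<in> B" "c u = c v" for u v
  proof (rule ccontr)
    assume nz: "c u \<noteq> 0"
    have "u \<in> V1" "v \<in> V2"
      using that V(4,5) by auto
    then have "c u = c1 u" "c v = (if c2 v = 0 then 0 else p (c2 v))"
      using c2_eq by (auto simp: c_def)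
    then have "c2 v \<noteq> 0" "c1 u \<noteq> 0" "c1 u = p (c2 v)"
      using that(3) nz by (auto split: if_splits)
    then have "c1 u \<in> p ` ?Y" "c1 u \<in> ?X"
      using that(1,2) imageI[of u A c1] by auto
    then show False
      using p(2) by (meson disjoint_iff)
  qed
  have conflict: "c u = 0 \<and> (u \<in> A \<and> v \<in> B \<or> u \<in> B \<and> v \<in> A)"
    if uv: "(u, v) \<in> join E1 E2 A B" "c u = c v" for u v
  proof -
    have "(u, v) \<notin> E1"
    proof
      assume "(u, v) \<in> E1"
      moreover from this have "u \<in> V1" "v \<in> V1"
        using V(1) by (auto simp: simple_on_def)
      ultimately show False
        using c(1) uv(2) by (simp add: proper_colouring_def c_def)
    qed
    moreover have "(u, v) \<notin> E2"
    proof
      assume E: "(u, v) \<in> E2"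
      then have V2: "u \<in> V2" "v \<in> V2"
        using V(2) by (auto simp: simple_on_def)
      have "c2 u \<noteq> c2 v"
        using c(2) E by (simp add: proper_colouring_def)
      then show False
        using uv(2) p_inj[of "c2 u" "c2 v"] lt2[OF V2(1)] lt2[OF V2(2)] z2[OF V2(1)] z2[OF V2(2)]
        by (auto simp: c2_eq[OF V2(1)] c2_eq[OF V2(2)])
    qed
    ultimately show ?thesis
      using uv cross[of u v] cross[of v u] by (auto simp: join_def)
  qed
  show ?thesis
  proof (intro exI[of _ c] conjI ballI allI impI, goal_cases)
    case (1 v)
    then show ?case
      by (simp add: c_def)
  next
    case (2 v)
    then show ?case
      by (rule z2)
  next
    case (3 v)
    then show ?case
      using lt[of v] lt2[of v] pD[of "c2 v"] by (auto simp: c_def)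
  qed (use conflict in blast)+
qed

lemma card_zero_class:
  fixes c c1 c2 :: "nat \<Rightarrow> nat"
  assumes "V1 \<inter> V2 = {}" "finite V1" "finite V2"
    and "\<And>v. v \<in> V1 \<Longrightarrow> c v = 0 \<longleftrightarrow> c1 v = 0" "\<And>v. v \<in> V2 \<Longrightarrow> c v = 0 \<longleftrightarrow> c2 v = 0"
  shows "card {v \<in> V1 \<union> V2. c v = 0} = card {v \<in> V1. c1 v = 0} + card {v \<in> V2. c2 v = 0}"
proof -
  have "{v \<in> V1 \<union> V2. c v = 0} \<inter> V1 = {v \<in> V1. c1 v = 0}"
    "{v \<in> V1 \<union> V2. c v = 0} \<inter> V2 = {v \<in> V2. c2 v = 0}"
    using assms by auto
  then show ?thesis
    using card_split[of "{v \<in> V1 \<union> V2. c v = 0}" V1 V2] assms(1-3) by auto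
qed

lemma glue_proper:
  assumes c: "proper_colouring (rel_graph V1 E1) k c1" "proper_colouring (rel_graph V2 E2) k c2"
    and V: "simple_on V1 E1" "simple_on V2 E2" "V1 \<inter> V2 = {}" "A \<subseteq> V1" "B \<subseteq> V2"
    and AB: "card A + card B \<le> k" and zero: "0 \<in> c1 ` A \<longleftrightarrow> 0 \<notin> c2 ` B"
  obtains c where "\<And>v. v \<in> V1 \<Longrightarrow> c v = 0 \<longleftrightarrow> c1 v = 0" "\<And>v. v \<in> V2 \<Longrightarrow> c v = 0 \<longleftrightarrow> c2 v = 0"
    "proper_colouring (rel_graph (V1 \<union> V2) (join E1 E2 A B)) k c"
    "card {v \<in> V1 \<union> V2. c v = 0} = card {v \<in> V1. c1 v = 0} + card {v \<in> V2. c2 v = 0}"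
proof -
  from zero have "0 \<in> c1 ` A \<or> 0 \<in> c2 ` B"
    by auto
  then obtain c where
    z: "\<forall>v \<in> V1. c v = 0 \<longleftrightarrow> c1 v = 0" "\<forall>v \<in> V2. c v = 0 \<longleftrightarrow> c2 v = 0"
    and c: "\<forall>v \<in> V1 \<union> V2. c v < k"
      "\<forall>u v. (u, v) \<in> join E1 E2 A B \<longrightarrow> c u = c v \<longrightarrow>
        c u = 0 \<and> (u \<in> A \<and> v \<in> B \<or> u \<in> B \<and> v \<in> A)"
    using glue_colourings[OF c V AB] by blast
  have "c u \<noteq> c v" if "(u, v) \<in> join E1 E2 A B" for u v
  proof
    assume eq: "c u = c v"
    then have "c u = 0" "c v = 0" "u \<in> A \<and> v \<in> B \<or> u \<in> B \<and> v \<in> A"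
      using c(2) that by auto
    then have "0 \<in> c1 ` A" "0 \<in> c2 ` B"
      using z V(4,5) by force+
    then show False
      using zero by simp
  qed
  then have "proper_colouring (rel_graph (V1 \<union> V2) (join E1 E2 A B)) k c"
    using c(1) by (simp add: proper_colouring_def)
  moreover have "finite V1" "finite V2"
    using V by (auto simp: simple_on_def)
  ultimately show ?thesis
    using that[of c] z card_zero_class[of V1 V2 c c1 c2] V(3) by blast
qed

section \<open>Clusters\<close>

text \<open>
  Colour \<open>0\<close> plays the role of the independent set to be removed, and every exit can be chosen as the
  only one that it contains.
\<close>
definition selectable :: "nat \<Rightarrow> nat set \<Rightarrow> (nat \<times> nat) set \<Rightarrow> nat set \<Rightarrow> nat \<Rightarrow> bool" where
  "selectable k V E L t \<longleftrightarrow> (\<forall>l \<in> L. \<exists>c. proper_colouring (rel_graph V E) k c \<and>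
     card {v \<in> V. c v = 0} = t \<and> {v \<in> L. c v = 0} = {l})"

definition cluster :: "nat \<Rightarrow> nat set \<Rightarrow> (nat \<times> nat) set \<Rightarrow> nat set \<Rightarrow> nat \<Rightarrow> bool" where
  "cluster k V E L t \<longleftrightarrow> simple_on V E \<and> L \<subseteq> V \<and> cliques_need k V E t \<and> forced k V E L t \<and>
     selectable k V E L t"

text \<open>
  The invariant behind the upper bound \<open>t + 1\<close> for independent sets: one vertex above the optimum,
  colour \<open>0\<close> can do without exits, so that all exits may be joined to vertices of colour \<open>0\<close>.
\<close>
definition avoidable :: "nat \<Rightarrow> nat set \<Rightarrow> (nat \<times> nat) set \<Rightarrow> nat set \<Rightarrow> nat \<Rightarrow> bool" where
  "avoidable k V E L t \<longleftrightarrow> (\<exists>c. proper_colouring (rel_graph V E) k c \<and>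
     card {v \<in> V. c v = 0} = Suc t \<and> {v \<in> L. c v = 0} = {})"

text \<open>
  Colour \<open>0\<close> need not be an independent set here, but removing its \<open>t\<close> vertices still leaves a
  \<open>(k - 1)\<close>-colourable graph.
\<close>
definition almost_colourable :: "nat \<Rightarrow> nat set \<Rightarrow> (nat \<times> nat) set \<Rightarrow> nat \<Rightarrow> bool" where
  "almost_colourable k V E t \<longleftrightarrow> (\<exists>c. (\<forall>v \<in> V. c v < k) \<and>
     (\<forall>(u, v) \<in> E. c u = c v \<longrightarrow> c u = 0) \<and> card {v \<in> V. c v = (0 :: nat)} = t)"

text \<open>
  An exit \<open>l\<close> that survives on one side is selected there, hence no vertex of that side of the join has
  colour \<open>0\<close>. On the other side some vertex of \<open>A\<close> or \<open>B\<close> is selected, which is no longer an exit.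
\<close>
lemma selectable_join:
  assumes sel: "selectable k V1 E1 L1 t1" "selectable k V2 E2 L2 t2"
    and V: "simple_on V1 E1" "simple_on V2 E2" "V1 \<inter> V2 = {}" "L1 \<subseteq> V1" "L2 \<subseteq> V2"
    and AB: "A \<subseteq> L1" "B \<subseteq> L2" "A \<noteq> {}" "B \<noteq> {}" "card A + card B \<le> k"
  shows "selectable k (V1 \<union> V2) (join E1 E2 A B) ((L1 - A) \<union> (L2 - B)) (t1 + t2)"
  unfolding selectable_def
proof
  fix l
  assume l: "l \<in> (L1 - A) \<union> (L2 - B)"
  obtain a b where ab: "a \<in> A" "b \<in> B"
    using AB by blast
  define l1 l2 where "l1 = (if l \<in> L1 - A then l else a)" and "l2 = (if l \<in> L1 - A then b else l)"
  have l12: "l1 \<in> L1" "l2 \<in> L2" "l1 \<in> A \<longleftrightarrow> l2 \<notin> B"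
    using l ab AB V by (auto simp: l1_def l2_def)
  obtain c1 where c1: "proper_colouring (rel_graph V1 E1) k c1" "card {v \<in> V1. c1 v = 0} = t1"
    "{v \<in> L1. c1 v = 0} = {l1}"
    using sel(1) l12(1) unfolding selectable_def by blast
  obtain c2 where c2: "proper_colouring (rel_graph V2 E2) k c2" "card {v \<in> V2. c2 v = 0} = t2"
    "{v \<in> L2. c2 v = 0} = {l2}"
    using sel(2) l12(2) unfolding selectable_def by blast
  have z1: "c1 v = 0 \<longleftrightarrow> v = l1" if "v \<in> L1" for v
    using c1(3) that by (auto simp: set_eq_iff)
  have z2: "c2 v = 0 \<longleftrightarrow> v = l2" if "v \<in> L2" for v
    using c2(3) that by (auto simp: set_eq_iff)
  have im: "0 \<in> c1 ` A \<longleftrightarrow> l1 \<in> A" "0 \<in> c2 ` B \<longleftrightarrow> l2 \<in> B"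
    using z1 z2 AB(1,2) l12 by (force simp: image_iff)+
  have "A \<subseteq> V1" "B \<subseteq> V2" "0 \<in> c1 ` A \<longleftrightarrow> 0 \<notin> c2 ` B"
    using V AB l12(3) im by auto
  from glue_proper[OF c1(1) c2(1) V(1-3) this(1,2) AB(5) this(3)] obtain c where
    c: "\<And>v. v \<in> V1 \<Longrightarrow> c v = 0 \<longleftrightarrow> c1 v = 0" "\<And>v. v \<in> V2 \<Longrightarrow> c v = 0 \<longleftrightarrow> c2 v = 0"
    "proper_colouring (rel_graph (V1 \<union> V2) (join E1 E2 A B)) k c"
    "card {v \<in> V1 \<union> V2. c v = 0} = card {v \<in> V1. c1 v = 0} + card {v \<in> V2. c2 v = 0}"
    by blast
  have zl: "c v = 0 \<longleftrightarrow> v = l" if v: "v \<in> (L1 - A) \<union> (L2 - B)" for v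
  proof (cases "v \<in> V1")
    case True
    then have v1: "v \<in> L1" "v \<notin> A"
      using v V(3,5) by auto
    then have "c v = 0 \<longleftrightarrow> v = l1"
      using c(1)[OF True] z1 by simp
    then show ?thesis
      using v1 ab(1) by (auto simp: l1_def)
  next
    case False
    then have v2: "v \<in> L2" "v \<notin> B" "v \<notin> L1"
      using v V(4) by auto
    then have "c v = 0 \<longleftrightarrow> v = l2"
      using c(2)[of v] z2[OF v2(1)] V(5) by (simp add: subset_iff)
    then show ?thesis
      using v2 ab(2) by (auto simp: l2_def)
  qed
  have "{v \<in> (L1 - A) \<union> (L2 - B). c v = 0} = {v \<in> (L1 - A) \<union> (L2 - B). v = l}"
    by (intro Collect_cong conj_cong refl zl)
  also have "\<dots> = {l}"
    using l by auto
  finally have "{v \<in> (L1 - A) \<union> (L2 - B). c v = 0} = {l}" .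
  moreover have "card {v \<in> V1 \<union> V2. c v = 0} = t1 + t2"
    using c(4) c1(2) c2(2) by simp
  ultimately show "\<exists>c. proper_colouring (rel_graph (V1 \<union> V2) (join E1 E2 A B)) k c \<and>
      card {v \<in> V1 \<union> V2. c v = 0} = t1 + t2 \<and> {v \<in> (L1 - A) \<union> (L2 - B). c v = 0} = {l}"
    using c(3) by (intro exI[of _ c] conjI) assumption+
qed

lemma cluster_join:
  assumes "cluster k V1 E1 L1 t1" "cluster k V2 E2 L2 t2" "V1 \<inter> V2 = {}"
    and "A \<subseteq> L1" "B \<subseteq> L2" "A \<noteq> {}" "B \<noteq> {}" "card A + card B \<le> k"
  shows "cluster k (V1 \<union> V2) (join E1 E2 A B) ((L1 - A) \<union> (L2 - B)) (t1 + t2)"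
proof -
  have fin: "finite V1" "finite V2"
    using assms(1,2) by (auto simp: cluster_def simple_on_def)
  have "simple_on (V1 \<union> V2) (join E1 E2 A B)"
    using assms by (intro simple_on_join) (auto simp: cluster_def)
  moreover have "(L1 - A) \<union> (L2 - B) \<subseteq> V1 \<union> V2"
    using assms(1,2) by (auto simp: cluster_def)
  ultimately show ?thesis
    using assms fin unfolding cluster_def
    by (simp add: cliques_need_join forced_join selectable_join)
qed

text \<open>
  Only the second cluster deviates from the optimum; the first one selects a vertex of \<open>A\<close>. For this
  reason the first cluster may be a complete graph, which is not avoidable.
\<close>
lemma avoidable_join:
  assumes C: "cluster k V1 E1 L1 t1" "cluster k V2 E2 L2 t2" "avoidable k V2 E2 L2 t2" "V1 \<inter> V2 = {}"
    and AB: "A \<subseteq> L1" "B \<subseteq> L2" "A \<noteq> {}" "card A + card B \<le> k"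
  shows "avoidable k (V1 \<union> V2) (join E1 E2 A B) ((L1 - A) \<union> (L2 - B)) (t1 + t2)"
proof -
  have V: "simple_on V1 E1" "simple_on V2 E2" "L1 \<subseteq> V1" "L2 \<subseteq> V2" "A \<subseteq> V1" "B \<subseteq> V2"
    using C AB by (auto simp: cluster_def)
  obtain a where a: "a \<in> A"
    using AB by blast
  obtain c1 where c1: "proper_colouring (rel_graph V1 E1) k c1" "card {v \<in> V1. c1 v = 0} = t1"
    "{v \<in> L1. c1 v = 0} = {a}"
    using C(1) AB(1) a unfolding cluster_def selectable_def by blast
  obtain c2 where c2: "proper_colouring (rel_graph V2 E2) k c2" "card {v \<in> V2. c2 v = 0} = Suc t2"
    "{v \<in> L2. c2 v = 0} = {}"
    using C(3) unfolding avoidable_def by blast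
  have "c1 a = 0"
    using c1(3) by blast
  then have "0 \<in> c1 ` A"
    using a by (force simp: image_iff)
  moreover have "0 \<notin> c2 ` B"
  proof
    assume "0 \<in> c2 ` B"
    then obtain b where "b \<in> B" "c2 b = 0"
      by auto
    then show False
      using c2(3) AB(2) by blast
  qed
  ultimately have "0 \<in> c1 ` A \<longleftrightarrow> 0 \<notin> c2 ` B"
    by simp
  from glue_proper[OF c1(1) c2(1) V(1,2) C(4) V(5,6) AB(4) this] obtain c where
    c: "\<And>v. v \<in> V1 \<Longrightarrow> c v = 0 \<longleftrightarrow> c1 v = 0" "\<And>v. v \<in> V2 \<Longrightarrow> c v = 0 \<longleftrightarrow> c2 v = 0"
    "proper_colouring (rel_graph (V1 \<union> V2) (join E1 E2 A B)) k c"
    "card {v \<in> V1 \<union> V2. c v = 0} = card {v \<in> V1. c1 v = 0} + card {v \<in> V2. c2 v = 0}"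
    by blast
  have "c v \<noteq> 0" if "v \<in> (L1 - A) \<union> (L2 - B)" for v
  proof (cases "v \<in> V1")
    case True
    then have "v \<in> L1" "v \<noteq> a"
      using that V(4) C(4) a by auto
    then show ?thesis
      using c(1)[OF True] c1(3) by (auto simp: set_eq_iff)
  next
    case False
    then have "v \<in> L2"
      using that V(3) by auto
    then show ?thesis
      using c(2)[of v] c2(3) V(4) by (simp add: set_eq_iff subset_iff)
  qed
  then have "{v \<in> (L1 - A) \<union> (L2 - B). c v = 0} = {}"
    by blast
  then show ?thesis
    unfolding avoidable_def using c(3,4) c1(2) c2(2) by auto
qed

text \<open>Both sides select a vertex of the join; the edge between these two is the only conflict.\<close>
lemma almost_colourable_join:
  assumes C: "cluster k V1 E1 L1 t1" "cluster k V2 E2 L2 t2" "V1 \<inter> V2 = {}"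
    and AB: "A \<subseteq> L1" "B \<subseteq> L2" "A \<noteq> {}" "B \<noteq> {}" "card A + card B \<le> k"
  shows "almost_colourable k (V1 \<union> V2) (join E1 E2 A B) (t1 + t2)"
proof -
  have V: "simple_on V1 E1" "simple_on V2 E2" "L1 \<subseteq> V1" "L2 \<subseteq> V2" "A \<subseteq> V1" "B \<subseteq> V2"
    using C AB by (auto simp: cluster_def)
  obtain a b where ab: "a \<in> A" "b \<in> B"
    using AB by blast
  obtain c1 where c1: "proper_colouring (rel_graph V1 E1) k c1" "card {v \<in> V1. c1 v = 0} = t1"
    "{v \<in> L1. c1 v = 0} = {a}"
    using C(1) AB(1) ab unfolding cluster_def selectable_def by blast
  obtain c2 where c2: "proper_colouring (rel_graph V2 E2) k c2" "card {v \<in> V2. c2 v = 0} = t2"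
    using C(2) AB(2) ab unfolding cluster_def selectable_def by blast
  have "c1 a = 0"
    using c1(3) by blast
  then have "0 \<in> c1 ` A \<or> 0 \<in> c2 ` B"
    using ab by (force simp: image_iff)
  then obtain c where
    z: "\<forall>v \<in> V1. c v = 0 \<longleftrightarrow> c1 v = 0" "\<forall>v \<in> V2. c v = 0 \<longleftrightarrow> c2 v = 0"
    and c: "\<forall>v \<in> V1 \<union> V2. c v < k"
      "\<forall>u v. (u, v) \<in> join E1 E2 A B \<longrightarrow> c u = c v \<longrightarrow>
        c u = 0 \<and> (u \<in> A \<and> v \<in> B \<or> u \<in> B \<and> v \<in> A)"
    using glue_colourings[OF c1(1) c2(1) V(1,2) C(3) V(5,6) AB(5)] by blast
  have "card {v \<in> V1 \<union> V2. c v = 0} = t1 + t2"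
    using card_zero_class[of V1 V2 c c1 c2] z V(1,2) C(3) c1(2) c2(2) by (simp add: simple_on_def)
  moreover have "\<forall>v \<in> V1 \<union> V2. c v < k" "\<forall>(u, v) \<in> join E1 E2 A B. c u = c v \<longrightarrow> c u = 0"
    using c by auto
  ultimately show ?thesis
    unfolding almost_colourable_def by blast
qed

section \<open>Building blocks\<close>

lemma cliques_need_one:
  assumes "finite V" "is_clique (rel_graph V E) K" "card K = k"
  shows "cliques_need k V E 1"
  unfolding cliques_need_def
proof (intro allI impI)
  fix S
  assume S: "S \<subseteq> V" "meets_cliques k (rel_graph V E) S"
  then have "S \<noteq> {}"
    using assms unfolding meets_cliques_def by blast
  moreover have "finite S"
    using S(1) assms(1) finite_subset by blast
  ultimately show "1 \<le> card S"
    by (simp add: Suc_le_eq card_gt_0_iff)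
qed

lemma proper_colouring_swap:
  assumes "proper_colouring G k c" "i < k" "j < k"
  shows "proper_colouring G k (\<lambda>v. transpose i j (c v))"
  unfolding proper_colouring_def
proof (intro conjI ballI allI impI)
  show "transpose i j (c v) < k" if "v \<in> verts G" for v
    using assms that by (auto simp: proper_colouring_def transpose_def)
  show "transpose i j (c u) \<noteq> transpose i j (c v)" if "u \<rightarrow>\<^bsub>G\<^esub> v" for u v
    using assms(1) that injD[OF inj_transpose, of i j "c u" "c v"] by (auto simp: proper_colouring_def)
qed

text \<open>
  A complete graph has one more exit than the next building block, with smaller degree, but every
  colour occurs exactly once in it.
\<close>
lemma cluster_complete:
  fixes N :: nat
  assumes "0 < k"
  defines "V \<equiv> {N..<N + k}"
  shows "cluster k V (V \<times> V - Id) V 1"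
    and "\<forall>v \<in> V. card ((V \<times> V - Id) `` {v}) = k - 1"
proof -
  let ?E = "V \<times> V - Id"
  have V: "finite V" "card V = k"
    by (auto simp: V_def)
  have "simple_on V ?E"
    using V by (auto simp: simple_on_def sym_def irrefl_def)
  moreover have "is_clique (rel_graph V ?E) V"
    by (auto simp: is_clique_def)
  then have "cliques_need k V ?E 1"
    using V cliques_need_one by blast
  moreover have "forced k V ?E V 1"
    by (auto simp: forced_def is_independent_def card_1_singleton_iff)
  moreover have "selectable k V ?E V 1"
    unfolding selectable_def
  proof
    fix l
    assume l: "l \<in> V"
    let ?c = "\<lambda>v. transpose 0 (l - N) (v - N)"
    have "proper_colouring (rel_graph V ?E) k (\<lambda>v. v - N)"
      by (auto simp: proper_colouring_def V_def)
    then have "proper_colouring (rel_graph V ?E) k ?c"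
      by (rule proper_colouring_swap) (use l assms in \<open>auto simp: V_def\<close>)
    moreover have "{v \<in> V. ?c v = 0} = {l}"
      using l by (auto simp: V_def transpose_def split: if_splits)
    ultimately show "\<exists>c. proper_colouring (rel_graph V ?E) k c \<and> card {v \<in> V. c v = 0} = 1 \<and>
        {v \<in> V. c v = 0} = {l}"
      by (intro exI[of _ ?c]) simp
  qed
  ultimately show "cluster k V ?E V 1"
    by (simp add: cluster_def)
  have "?E `` {v} = V - {v}" if "v \<in> V" for v
    using that by auto
  then show "\<forall>v \<in> V. card (?E `` {v}) = k - 1"
    using V by simp
qed

text \<open>
  \<open>K\<^bsub>k+1\<^esub>\<close> without the edge between its last two vertices, the twins. The twins receive the same colour:
  a nonzero one if an exit has colour \<open>0\<close>, and \<open>0\<close> if no exit is to have it.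
\<close>
lemma cluster_twin:
  fixes N :: nat
  assumes "2 \<le> k"
  defines "V \<equiv> {N..<N + k + 1}"
  defines "L \<equiv> {N..<N + k - 1}"
  defines "E \<equiv> V \<times> V - Id - {(N + k - 1, N + k), (N + k, N + k - 1)}"
  shows "cluster k V E L 1" "avoidable k V E L 1" "\<forall>v \<in> V. card (E `` {v}) \<le> k"
proof -
  have V: "finite V" "card V = k + 1"
    by (auto simp: V_def)
  have "simple_on V E"
    using V by (auto simp: simple_on_def sym_def irrefl_def E_def)
  moreover have "L \<subseteq> V"
    by (auto simp: L_def V_def)
  moreover have cl: "is_clique (rel_graph V E) (insert x L)" "card (insert x L) = k"
    if "x = N + k - 1 \<or> x = N + k" for x
  proof -
    show "is_clique (rel_graph V E) (insert x L)"
      using that assms(1) by (auto simp: is_clique_def E_def V_def L_def)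
    have "x \<notin> L"
      using that assms(1) by (auto simp: L_def)
    then show "card (insert x L) = k"
      using assms(1) by (simp add: L_def)
  qed
  then have "cliques_need k V E 1"
    using V cliques_need_one by blast
  moreover have "forced k V E L 1"
    unfolding forced_def
  proof (intro allI impI)
    fix S
    assume S: "is_independent (rel_graph V E) S" "meets_cliques k (rel_graph V E) S" "card S = 1"
    obtain s where s: "S = {s}"
      using S(3) by (auto simp: card_1_singleton_iff)
    have "S \<inter> insert (N + k - 1) L \<noteq> {}" "S \<inter> insert (N + k) L \<noteq> {}"
      using S(2) cl unfolding meets_cliques_def by blast+
    then show "S \<inter> L \<noteq> {}"
      using s assms(1) by auto
  qed
  moreover have "selectable k V E L 1"
    unfolding selectable_def
  proof
    fix l
    assume l: "l \<in> L"
    \<comment> \<open>The minimum identifies the colours of the twins; the transposition moves colour \<open>0\<close> to \<open>l\<close>.\<close>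
    let ?c = "\<lambda>v. transpose 0 (l - N) (min (v - N) (k - 1))"
    have "proper_colouring (rel_graph V E) k (\<lambda>v. min (v - N) (k - 1))"
      using assms(1) by (auto simp: proper_colouring_def V_def E_def min_def split: if_splits)
    then have "proper_colouring (rel_graph V E) k ?c"
      by (rule proper_colouring_swap) (use l assms in \<open>auto simp: L_def\<close>)
    moreover have z: "?c v = 0 \<longleftrightarrow> v = l" if "v \<in> V" for v
      using l that by (auto simp: V_def L_def transpose_def min_def split: if_splits)
    have "{v \<in> V. ?c v = 0} = {l}" "{v \<in> L. ?c v = 0} = {l}"
      using l z \<open>L \<subseteq> V\<close> by auto
    ultimately show "\<exists>c. proper_colouring (rel_graph V E) k c \<and> card {v \<in> V. c v = 0} = 1 \<and>
        {v \<in> L. c v = 0} = {l}"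
      by (intro exI[of _ ?c]) simp
  qed
  ultimately show "cluster k V E L 1"
    by (simp add: cluster_def)
  let ?c = "\<lambda>v. if N + k - 1 \<le> v then 0 else Suc (v - N)"
  have "proper_colouring (rel_graph V E) k ?c"
    using assms(1) by (auto simp: proper_colouring_def V_def E_def)
  moreover have "{v \<in> V. ?c v = 0} = {N + k - 1, N + k}"
    using assms(1) by (auto simp: V_def)
  then have "card {v \<in> V. ?c v = 0} = Suc 1"
    using assms(1) by auto
  moreover have "{v \<in> L. ?c v = 0} = {}"
    by (auto simp: L_def)
  ultimately show "avoidable k V E L 1"
    unfolding avoidable_def by blast
  show "\<forall>v \<in> V. card (E `` {v}) \<le> k"
  proof
    fix v
    assume "v \<in> V"
    have "E `` {v} \<subseteq> V - {v}"
      by (auto simp: E_def)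
    then have "card (E `` {v}) \<le> card (V - {v})"
      using V(1) by (intro card_mono) auto
    then show "card (E `` {v}) \<le> k"
      using V \<open>v \<in> V\<close> by simp
  qed
qed

section \<open>Assembly\<close>

text \<open>
  The cluster is required to exist beyond every bound \<open>N\<close> so that any finite number of disjoint copies
  is available. Every exit can still be joined to \<open>m\<close> further vertices.
\<close>
definition assembly :: "nat \<Rightarrow> nat \<Rightarrow> nat \<Rightarrow> nat \<Rightarrow> bool" where
  "assembly k \<Delta> m l \<longleftrightarrow> (\<forall>N. \<exists>V E L t. V \<subseteq> {N..} \<and> cluster k V E L t \<and> avoidable k V E L t \<and>
     (\<forall>v \<in> V. card (E `` {v}) \<le> \<Delta>) \<and> (\<forall>v \<in> L. card (E `` {v}) + m \<le> \<Delta>) \<and> card L = l)"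

text \<open>
  A cluster without exits, in which the optimum \<open>t\<close> is attained by some set of vertices, whereas
  independent sets need \<open>t + 1\<close>.
\<close>
definition gap :: "nat \<Rightarrow> nat set \<Rightarrow> (nat \<times> nat) set \<Rightarrow> nat \<Rightarrow> bool" where
  "gap k V E t \<longleftrightarrow> simple_on V E \<and> cliques_need k V E t \<and> forced k V E {} t \<and>
     avoidable k V E {} t \<and> almost_colourable k V E t"

lemma above_finite:
  fixes V :: "nat set"
  assumes "finite V"
  shows "\<exists>N. \<forall>W. W \<subseteq> {N..} \<longrightarrow> V \<inter> W = {}"
proof -
  have "V \<inter> W = {}" if "W \<subseteq> {Suc (Max (insert 0 V))..}" for W
  proof -
    have "v \<le> Max (insert 0 V)" if "v \<in> V" for v
      using assms that by simp
    then show ?thesis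
      using that by fastforce
  qed
  then show ?thesis
    by blast
qed

lemma assembly_pair:
  assumes "assembly k \<Delta> m l"
  obtains V1 E1 L1 t1 V2 E2 L2 t2 where
    "V1 \<subseteq> {N..}" "cluster k V1 E1 L1 t1" "avoidable k V1 E1 L1 t1"
    "\<forall>v \<in> V1. card (E1 `` {v}) \<le> \<Delta>" "\<forall>v \<in> L1. card (E1 `` {v}) + m \<le> \<Delta>" "card L1 = l"
    "V2 \<subseteq> {N..}" "cluster k V2 E2 L2 t2" "avoidable k V2 E2 L2 t2"
    "\<forall>v \<in> V2. card (E2 `` {v}) \<le> \<Delta>" "\<forall>v \<in> L2. card (E2 `` {v}) + m \<le> \<Delta>" "card L2 = l"
    "V1 \<inter> V2 = {}"
proof -
  obtain V1 E1 L1 t1 where 1: "V1 \<subseteq> {N..}" "cluster k V1 E1 L1 t1" "avoidable k V1 E1 L1 t1"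
    "\<forall>v \<in> V1. card (E1 `` {v}) \<le> \<Delta>" "\<forall>v \<in> L1. card (E1 `` {v}) + m \<le> \<Delta>" "card L1 = l"
    using assms unfolding assembly_def by meson
  then have "finite V1"
    by (simp add: cluster_def simple_on_def)
  then obtain N' where N': "\<forall>W. W \<subseteq> {N'..} \<longrightarrow> V1 \<inter> W = {}"
    using above_finite by blast
  obtain V2 E2 L2 t2 where 2: "V2 \<subseteq> {max N N'..}" "cluster k V2 E2 L2 t2" "avoidable k V2 E2 L2 t2"
    "\<forall>v \<in> V2. card (E2 `` {v}) \<le> \<Delta>" "\<forall>v \<in> L2. card (E2 `` {v}) + m \<le> \<Delta>" "card L2 = l"
    using assms unfolding assembly_def by meson
  have "V2 \<subseteq> {N..}" "V2 \<subseteq> {N'..}"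
    using 2(1) by auto
  then have "V2 \<subseteq> {N..}" "V1 \<inter> V2 = {}"
    using N' by auto
  then show ?thesis
    by (rule that[OF 1 _ 2(2-6)])
qed

lemma degree_join_bound:
  assumes "simple_on V1 E1" "simple_on V2 E2" "V1 \<inter> V2 = {}" "A \<subseteq> V1" "B \<subseteq> V2"
    and "\<forall>v \<in> V1. card (E1 `` {v}) \<le> \<Delta>" "\<forall>v \<in> V2. card (E2 `` {v}) \<le> \<Delta>"
    and "\<forall>v \<in> A. card (E1 `` {v}) + card B \<le> \<Delta>" "\<forall>v \<in> B. card (E2 `` {v}) + card A \<le> \<Delta>"
  shows "\<forall>v \<in> V1 \<union> V2. card (join E1 E2 A B `` {v}) \<le> \<Delta>"
proof
  fix v
  assume "v \<in> V1 \<union> V2"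
  then show "card (join E1 E2 A B `` {v}) \<le> \<Delta>"
  proof
    assume v: "v \<in> V1"
    then have "card (E1 `` {v}) + (if v \<in> A then card B else 0) \<le> \<Delta>"
      using assms(6,8) by simp
    then show ?thesis
      using degree_join(1)[OF assms(1-5) v] by linarith
  next
    assume v: "v \<in> V2"
    then have "card (E2 `` {v}) + (if v \<in> B then card A else 0) \<le> \<Delta>"
      using assms(7,9) by simp
    then show ?thesis
      using degree_join(2)[OF assms(1-5) v] by linarith
  qed
qed

lemma assembly_double:
  assumes "assembly k \<Delta> m l" "0 < m" "m \<le> l" "2 * m \<le> k"
  shows "assembly k \<Delta> m (2 * (l - m))"
  unfolding assembly_def
proof
  fix N
  obtain V1 E1 L1 t1 V2 E2 L2 t2 where
    1: "V1 \<subseteq> {N..}" "cluster k V1 E1 L1 t1" "avoidable k V1 E1 L1 t1"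
    "\<forall>v \<in> V1. card (E1 `` {v}) \<le> \<Delta>" "\<forall>v \<in> L1. card (E1 `` {v}) + m \<le> \<Delta>" "card L1 = l"
    and 2: "V2 \<subseteq> {N..}" "cluster k V2 E2 L2 t2" "avoidable k V2 E2 L2 t2"
    "\<forall>v \<in> V2. card (E2 `` {v}) \<le> \<Delta>" "\<forall>v \<in> L2. card (E2 `` {v}) + m \<le> \<Delta>" "card L2 = l"
    and disj: "V1 \<inter> V2 = {}"
    using assembly_pair[OF assms(1), of N] .
  obtain A where A: "A \<subseteq> L1" "card A = m"
    using assms(3) 1(6) obtain_subset_with_card_n by metis
  obtain B where B: "B \<subseteq> L2" "card B = m"
    using assms(3) 2(6) obtain_subset_with_card_n by metis
  have ne: "A \<noteq> {}" "B \<noteq> {}" and AB: "card A + card B \<le> k"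
    using A B assms by auto
  have s: "simple_on V1 E1" "simple_on V2 E2" "L1 \<subseteq> V1" "L2 \<subseteq> V2" "A \<subseteq> V1" "B \<subseteq> V2"
    "finite V1" "finite V2"
    using 1 2 A B by (auto simp: cluster_def simple_on_def)
  have fin: "finite A" "finite B"
    using A B assms by (auto intro: card_ge_0_finite)
  let ?E = "join E1 E2 A B" and ?L = "(L1 - A) \<union> (L2 - B)"
  have "\<forall>v \<in> V1 \<union> V2. card (?E `` {v}) \<le> \<Delta>"
    using s disj 1 2 A B by (intro degree_join_bound) auto
  moreover have "\<forall>v \<in> ?L. card (?E `` {v}) + m \<le> \<Delta>"
  proof
    fix v
    assume "v \<in> ?L"
    then show "card (?E `` {v}) + m \<le> \<Delta>"
      using degree_join[OF s(1,2) disj s(5,6), of v] 1(5) 2(5) s(3,4) disj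
      by fastforce
  qed
  moreover have "card ?L = 2 * (l - m)"
  proof -
    have "card ?L = card (L1 - A) + card (L2 - B)"
      using s disj by (intro card_Un_disjoint) (auto intro: finite_subset)
    then show ?thesis
      using A B 1(6) 2(6) fin by (simp add: card_Diff_subset)
  qed
  moreover have "V1 \<union> V2 \<subseteq> {N..}"
    using 1 2 by auto
  ultimately show "\<exists>V E L t. V \<subseteq> {N..} \<and> cluster k V E L t \<and> avoidable k V E L t \<and>
      (\<forall>v \<in> V. card (E `` {v}) \<le> \<Delta>) \<and> (\<forall>v \<in> L. card (E `` {v}) + m \<le> \<Delta>) \<and> card L = 2 * (l - m)"
    using cluster_join[OF 1(2) 2(2) disj A(1) B(1) ne AB]
      avoidable_join[OF 1(2) 2(2) 2(3) disj A(1) B(1) ne(1) AB]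
    by (intro exI[of _ "V1 \<union> V2"] exI[of _ ?E] exI[of _ ?L] exI[of _ "t1 + t2"] conjI)
qed

lemma assembly_close:
  assumes "assembly k \<Delta> m l" "0 < l" "l \<le> m" "2 * m \<le> k"
  shows "\<exists>V E t. gap k V E t \<and> (\<forall>v \<in> V. card (E `` {v}) \<le> \<Delta>)"
proof -
  obtain V1 E1 L1 t1 V2 E2 L2 t2 where
    1: "V1 \<subseteq> {0..}" "cluster k V1 E1 L1 t1" "avoidable k V1 E1 L1 t1"
    "\<forall>v \<in> V1. card (E1 `` {v}) \<le> \<Delta>" "\<forall>v \<in> L1. card (E1 `` {v}) + m \<le> \<Delta>" "card L1 = l"
    and 2: "V2 \<subseteq> {0..}" "cluster k V2 E2 L2 t2" "avoidable k V2 E2 L2 t2"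
    "\<forall>v \<in> V2. card (E2 `` {v}) \<le> \<Delta>" "\<forall>v \<in> L2. card (E2 `` {v}) + m \<le> \<Delta>" "card L2 = l"
    and disj: "V1 \<inter> V2 = {}"
    using assembly_pair[OF assms(1), of 0] .
  have ne: "L1 \<noteq> {}" "L2 \<noteq> {}" and AB: "card L1 + card L2 \<le> k"
    using 1 2 assms by auto
  let ?E = "join E1 E2 L1 L2"
  have "cluster k (V1 \<union> V2) ?E {} (t1 + t2)"
    using cluster_join[OF 1(2) 2(2) disj subset_refl subset_refl ne AB] by simp
  moreover have "avoidable k (V1 \<union> V2) ?E {} (t1 + t2)"
    using avoidable_join[OF 1(2) 2(2) 2(3) disj subset_refl subset_refl ne(1) AB] by simp
  moreover have "almost_colourable k (V1 \<union> V2) ?E (t1 + t2)"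
    by (rule almost_colourable_join[OF 1(2) 2(2) disj subset_refl subset_refl ne AB])
  ultimately have "gap k (V1 \<union> V2) ?E (t1 + t2)"
    by (simp add: gap_def cluster_def)
  moreover have "\<forall>v \<in> V1 \<union> V2. card (?E `` {v}) \<le> \<Delta>"
  proof (rule degree_join_bound)
    show "simple_on V1 E1" "simple_on V2 E2" "L1 \<subseteq> V1" "L2 \<subseteq> V2"
      using 1 2 by (auto simp: cluster_def)
    show "\<forall>v \<in> L1. card (E1 `` {v}) + card L2 \<le> \<Delta>" "\<forall>v \<in> L2. card (E2 `` {v}) + card L1 \<le> \<Delta>"
      using 1(5,6) 2(5,6) assms(3) by fastforce+
  qed (use 1 2 disj in auto)
  ultimately show ?thesis
    by blast
qed

text \<open>For \<open>m < l < 2m\<close> one has \<open>0 < 2(l - m) < l\<close>, so doubling ends with at most \<open>m\<close> exits.\<close>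
lemma assembly_gap:
  assumes "0 < m" "2 * m \<le> k"
  shows "assembly k \<Delta> m l \<Longrightarrow> 0 < l \<Longrightarrow> l < 2 * m \<Longrightarrow>
    \<exists>V E t. gap k V E t \<and> (\<forall>v \<in> V. card (E `` {v}) \<le> \<Delta>)"
proof (induction l rule: less_induct)
  case (less l)
  show ?case
  proof (cases "l \<le> m")
    case True
    then show ?thesis
      using less.prems assms assembly_close by blast
  next
    case False
    then have "assembly k \<Delta> m (2 * (l - m))"
      using less.prems assms by (intro assembly_double) auto
    moreover have "2 * (l - m) < l" "0 < 2 * (l - m)" "2 * (l - m) < 2 * m"
      using False less.prems by auto
    ultimately show ?thesis
      using less.IH by blast
  qed
qed

lemma ex_twin:
  assumes "2 \<le> k"
  shows "\<exists>V E L. V \<subseteq> {N..} \<and> cluster k V E L 1 \<and> avoidable k V E L 1 \<and>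
    (\<forall>v \<in> V. card (E `` {v}) \<le> k) \<and> card L = k - 1"
proof -
  let ?V = "{N..<N + k + 1}"
  have "?V \<subseteq> {N..}" "card {N..<N + k - 1} = k - 1"
    by auto
  then show ?thesis
    using cluster_twin[OF assms, of N] by blast
qed

lemma assembly_even:
  assumes "0 < m" "3 * m \<le> \<Delta>"
  shows "assembly (2 * m) \<Delta> m (2 * m - 1)"
  unfolding assembly_def
proof
  fix N :: nat
  have "2 \<le> 2 * m"
    using assms by simp
  from ex_twin[OF this, of N] obtain V E L where C: "V \<subseteq> {N..}" "cluster (2 * m) V E L 1"
    "avoidable (2 * m) V E L 1" "\<forall>v \<in> V. card (E `` {v}) \<le> 2 * m" "card L = 2 * m - 1"
    by blast
  have deg: "card (E `` {v}) + m \<le> \<Delta>" if "v \<in> V" for v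
    using bspec[OF C(4) that] assms(2) by linarith
  have "\<forall>v \<in> V. card (E `` {v}) \<le> \<Delta>"
    using deg add_leD1 by blast
  moreover have "\<forall>v \<in> L. card (E `` {v}) + m \<le> \<Delta>"
    using deg C(2) by (auto simp: cluster_def)
  ultimately show "\<exists>V E L t. V \<subseteq> {N..} \<and> cluster (2 * m) V E L t \<and> avoidable (2 * m) V E L t \<and>
      (\<forall>v \<in> V. card (E `` {v}) \<le> \<Delta>) \<and> (\<forall>v \<in> L. card (E `` {v}) + m \<le> \<Delta>) \<and> card L = 2 * m - 1"
    using C(1-3,5) by (intro exI[of _ V] exI[of _ E] exI[of _ L] exI[of _ 1] conjI)
qed

text \<open>
  The vertices of \<open>K\<^bsub>2m+1\<^esub>\<close> have degree \<open>2m\<close>, one less than the exits of the other building block, and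
  can therefore take \<open>m + 1\<close> new edges instead of \<open>m\<close>. Two disjoint sets \<open>Q1\<close> and \<open>Q2\<close> of \<open>m\<close> of them are
  joined to \<open>m + 1\<close> exits in one building block each, which uses all \<open>2m + 1\<close> colours. One vertex of
  the complete graph and \<open>m - 1\<close> exits of each building block are left, \<open>2m - 1\<close> in total.
\<close>
lemma assembly_odd:
  assumes "0 < m" "3 * m + 1 \<le> \<Delta>"
  shows "assembly (2 * m + 1) \<Delta> m (2 * m - 1)"
  unfolding assembly_def
proof
  fix N :: nat
  let ?k = "2 * m + 1"
  let ?Q = "{N..<N + ?k}" and ?Q1 = "{N..<N + m}" and ?Q2 = "{N + m..<N + 2 * m}"
  let ?F = "?Q \<times> ?Q - Id"
  have Q: "cluster ?k ?Q ?F ?Q 1" "\<And>v. v \<in> ?Q \<Longrightarrow> card (?F `` {v}) = 2 * m"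
    using cluster_complete[of ?k N] by auto
  have k: "2 \<le> ?k"
    using assms by simp
  obtain V1 E1 L1 where 1: "V1 \<subseteq> {N + ?k..}" "cluster ?k V1 E1 L1 1" "avoidable ?k V1 E1 L1 1"
    "\<forall>v \<in> V1. card (E1 `` {v}) \<le> ?k" "card L1 = 2 * m"
    using ex_twin[OF k, of "N + ?k"] by auto
  obtain T1 where T1: "T1 \<subseteq> L1" "card T1 = m + 1"
    using obtain_subset_with_card_n[of "m + 1" L1] 1(5) assms(1) by auto
  have s1: "simple_on ?Q ?F" "simple_on V1 E1" "L1 \<subseteq> V1" "?Q1 \<subseteq> ?Q" "T1 \<subseteq> V1" "finite V1"
    using Q(1) 1(2) T1 by (auto simp: cluster_def simple_on_def)
  have d1: "?Q \<inter> V1 = {}"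
    using 1(1) by auto
  let ?V = "?Q \<union> V1" and ?E = "join ?F E1 ?Q1 T1" and ?L = "(?Q - ?Q1) \<union> (L1 - T1)"
  have ne: "?Q1 \<noteq> {}" "?Q2 \<noteq> {}" "T1 \<noteq> {}"
    using assms(1) T1 by auto
  have C: "cluster ?k ?V ?E ?L (1 + 1)"
    using T1 ne by (intro cluster_join Q(1) 1(2) d1) auto
  then have sC: "simple_on ?V ?E" "finite ?V" "?L \<subseteq> ?V"
    by (auto simp: cluster_def simple_on_def)
  have deg1: "\<forall>v \<in> ?V. card (?E `` {v}) \<le> \<Delta>"
    using T1 s1 d1 Q(2) 1(4) assms(2) by (intro degree_join_bound) fastforce+
  have degQ: "card (?E `` {v}) \<le> 2 * m" if "v \<in> ?Q - ?Q1" for v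
    using degree_join(1)[OF s1(1,2) d1 s1(4,5), of v] Q(2)[of v] that by auto
  have degL: "card (?E `` {v}) \<le> ?k" if "v \<in> ?L" for v
  proof (cases "v \<in> ?Q")
    case True
    then show ?thesis
      using degQ[of v] that d1 s1(3) by force
  next
    case False
    then have "v \<in> V1" "v \<notin> T1"
      using that s1(3) by auto
    then show ?thesis
      using degree_join(2)[OF s1(1,2) d1 s1(4,5), of v] 1(4) by fastforce
  qed
  obtain N' where N': "\<forall>W. W \<subseteq> {N'..} \<longrightarrow> ?V \<inter> W = {}"
    using above_finite[OF sC(2)] by blast
  obtain V2 E2 L2 where 2: "V2 \<subseteq> {max N N'..}" "cluster ?k V2 E2 L2 1" "avoidable ?k V2 E2 L2 1"
    "\<forall>v \<in> V2. card (E2 `` {v}) \<le> ?k" "card L2 = 2 * m"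
    using ex_twin[OF k, of "max N N'"] by auto
  have "V2 \<subseteq> {N'..}"
    using 2(1) by auto
  then have d2: "?V \<inter> V2 = {}"
    using N' by blast
  obtain T2 where T2: "T2 \<subseteq> L2" "card T2 = m + 1"
    using obtain_subset_with_card_n[of "m + 1" L2] 2(5) assms(1) by auto
  have s2: "simple_on V2 E2" "L2 \<subseteq> V2" "?Q2 \<subseteq> ?V" "T2 \<subseteq> V2" "finite V2"
    using 2(2) T2 by (auto simp: cluster_def simple_on_def)
  have Q2: "?Q2 \<subseteq> ?L" "?Q2 \<subseteq> ?Q - ?Q1"
    by auto
  have T2ne: "T2 \<noteq> {}" and sum: "card ?Q2 + card T2 \<le> ?k"
    using T2 by auto
  let ?W = "?V \<union> V2" and ?H = "join ?E E2 ?Q2 T2" and ?M = "(?L - ?Q2) \<union> (L2 - T2)"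
  have "cluster ?k ?W ?H ?M (1 + 1 + 1)"
    by (rule cluster_join[OF C 2(2) d2 Q2(1) T2(1) ne(2) T2ne sum])
  moreover have "avoidable ?k ?W ?H ?M (1 + 1 + 1)"
    by (rule avoidable_join[OF C 2(2,3) d2 Q2(1) T2(1) ne(2) sum])
  moreover have "\<forall>v \<in> ?W. card (?H `` {v}) \<le> \<Delta>"
  proof (rule degree_join_bound[OF sC(1) s2(1) d2 s2(3,4) deg1])
    show "\<forall>v \<in> ?Q2. card (?E `` {v}) + card T2 \<le> \<Delta>"
      using degQ Q2(2) T2(2) assms(2) by fastforce
    show "\<forall>v \<in> V2. card (E2 `` {v}) \<le> \<Delta>"
      using 2(4) assms by fastforce
    show "\<forall>v \<in> T2. card (E2 `` {v}) + card ?Q2 \<le> \<Delta>"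
      using 2(4) s2(4) assms by fastforce
  qed
  moreover have "\<forall>v \<in> ?M. card (?H `` {v}) + m \<le> \<Delta>"
  proof
    fix v
    assume v: "v \<in> ?M"
    have "card (?H `` {v}) \<le> ?k"
    proof (cases "v \<in> V2")
      case True
      then have "v \<notin> T2"
        using v sC(3) d2 by blast
      then show ?thesis
        using True degree_join(2)[OF sC(1) s2(1) d2 s2(3,4), of v] 2(4) by fastforce
    next
      case False
      then have "v \<in> ?L" "v \<notin> ?Q2" "v \<in> ?V"
        using v sC(3) s2(2) by blast+
      then show ?thesis
        using degree_join(1)[OF sC(1) s2(1) d2 s2(3,4), of v] degL[of v] by auto
    qed
    then show "card (?H `` {v}) + m \<le> \<Delta>"
      using assms(2) by simp
  qed
  moreover have "card ?M = 2 * m - 1"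
  proof -
    have fin: "finite L1" "finite T1" "finite L2" "finite T2"
      using s1 s2 T1 T2 finite_subset by metis+
    have "?M = {N + 2 * m} \<union> ((L1 - T1) \<union> (L2 - T2))"
      using s1(3) 1(1) by auto
    moreover have "card ((L1 - T1) \<union> (L2 - T2)) = card (L1 - T1) + card (L2 - T2)"
      using fin s1 s2 d2 by (intro card_Un_disjoint) auto
    moreover have "N + 2 * m \<in> ?Q"
      by simp
    then have "N + 2 * m \<notin> (L1 - T1) \<union> (L2 - T2)"
      using s1(3) s2(2) d1 d2 by blast
    ultimately show ?thesis
      using fin T1 T2 1(5) 2(5) assms(1) by (simp add: card_Diff_subset)
  qed
  moreover have "?W \<subseteq> {N..}"
    using 1(1) 2(1) by auto
  ultimately show "\<exists>V E L t. V \<subseteq> {N..} \<and> cluster ?k V E L t \<and> avoidable ?k V E L t \<and>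
      (\<forall>v \<in> V. card (E `` {v}) \<le> \<Delta>) \<and> (\<forall>v \<in> L. card (E `` {v}) + m \<le> \<Delta>) \<and> card L = 2 * m - 1"
    by (intro exI[of _ ?W] exI[of _ ?H] exI[of _ ?M] exI[of _ "1 + 1 + 1"] conjI) assumption+
qed

section \<open>Exact maximum degree\<close>

text \<open>
  A disjoint \<open>k\<close>-clique with pendant edges at one of its vertices \<open>N\<close> raises the maximum degree to
  exactly \<open>\<Delta>\<close>. It adds \<open>1\<close> to all sizes, as removing \<open>N\<close> destroys it. The clique makes the cases \<open>k = 2\<close>, where the
  pendant edges are themselves \<open>k\<close>-cliques, and \<open>k > 2\<close> alike.
\<close>
lemma gap_pad:
  assumes g: "gap k V E t" and deg: "\<forall>v \<in> V. card (E `` {v}) \<le> \<Delta>" and k: "2 \<le> k" "k \<le> \<Delta> + 1"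
  shows "\<exists>V' E' t'. gap k V' E' t' \<and> 0 < t' \<and> (\<forall>v \<in> V'. card (E' `` {v}) \<le> \<Delta>) \<and>
    (\<exists>v \<in> V'. card (E' `` {v}) = \<Delta>)"
proof -
  have sV: "simple_on V E" "finite V"
    using g by (auto simp: gap_def simple_on_def)
  then obtain N where N: "\<forall>W. W \<subseteq> {N..} \<longrightarrow> V \<inter> W = {}"
    using above_finite by blast
  let ?P = "{N..N + \<Delta>}" and ?K = "{N..<N + k}"
  let ?F = "(?K \<times> ?K \<union> {N} \<times> ?P \<union> ?P \<times> {N}) - Id"
  let ?W = "V \<union> ?P" and ?E = "join E ?F {} {}"
  have disj: "V \<inter> ?P = {}"
    using N by auto
  have sP: "simple_on ?P ?F"
    using k by (auto simp: simple_on_def sym_def irrefl_def)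
  have "is_clique (rel_graph ?P ?F) ?K"
    using k by (auto simp: is_clique_def)
  then have nP: "cliques_need k ?P ?F 1"
    by (intro cliques_need_one) auto
  let ?d = "\<lambda>v. if v < N + k then v - N else 1"
  have d: "\<forall>v \<in> ?P. ?d v < k" "\<And>u v. (u, v) \<in> ?F \<Longrightarrow> ?d u \<noteq> ?d v" "{v \<in> ?P. ?d v = 0} = {N}"
    using k by (auto split: if_splits)
  have need: "cliques_need k ?W ?E (t + 1)"
    using g nP sV disj by (intro cliques_need_join) (auto simp: gap_def)
  have forced: "forced k ?W ?E {} (t + 1)"
    unfolding forced_def
  proof (intro allI impI)
    fix S
    assume S: "is_independent (rel_graph ?W ?E) S" "meets_cliques k (rel_graph ?W ?E) S"
      "card S = t + 1"
    have "card (S \<inter> V) = t"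
      using join_tight_parts(1)[OF _ nP disj sV(2) _ S] g by (auto simp: gap_def)
    then have "S \<inter> V \<inter> {} \<noteq> {}"
      using g is_independent_join(1)[OF S(1)] meets_cliques_join(1)[OF S(2)]
      unfolding gap_def forced_def by blast
    then show "S \<inter> {} \<noteq> {}"
      by simp
  qed
  have combine: "\<exists>c. (\<forall>v \<in> V. c v = c1 v) \<and> (\<forall>v \<in> ?W. c v < k) \<and> (\<forall>v \<in> ?P. c v = ?d v) \<and>
      card {v \<in> ?W. c v = 0} = card {v \<in> V. c1 v = 0} + 1"
    if "\<forall>v \<in> V. c1 v < k" for c1 :: "nat \<Rightarrow> nat"
  proof -
    let ?c = "\<lambda>v. if v \<in> V then c1 v else ?d v"
    have eq: "\<forall>v \<in> V. ?c v = c1 v" "\<forall>v \<in> ?P. ?c v = ?d v"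
      using disj by auto
    then have "card {v \<in> ?W. ?c v = 0} = card {v \<in> V. c1 v = 0} + card {v \<in> ?P. ?d v = 0}"
      using sV disj by (intro card_zero_class) auto
    then have "card {v \<in> ?W. ?c v = 0} = card {v \<in> V. c1 v = 0} + 1"
      using d(3) by simp
    moreover have "\<forall>v \<in> ?W. ?c v < k"
      using that d(1) by auto
    ultimately show ?thesis
      using eq by (intro exI[of _ ?c] conjI) assumption+
  qed
  have ends: "u \<in> V \<and> v \<in> V" if "(u, v) \<in> E" for u v
    using that sV by (auto simp: simple_on_def)
  have endsP: "u \<in> ?P \<and> v \<in> ?P" if "(u, v) \<in> ?F" for u v
    using that sP unfolding simple_on_def by blast
  have split: "(u, v) \<in> E \<or> (u, v) \<in> ?F" if "(u, v) \<in> ?E" for u v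
    using that by (simp add: join_def)
  have "avoidable k ?W ?E {} (t + 1)"
  proof -
    obtain c1 where c1: "proper_colouring (rel_graph V E) k c1" "card {v \<in> V. c1 v = 0} = Suc t"
      using g unfolding gap_def avoidable_def by blast
    then obtain c where c: "\<forall>v \<in> V. c v = c1 v" "\<forall>v \<in> ?W. c v < k" "\<forall>v \<in> ?P. c v = ?d v"
      "card {v \<in> ?W. c v = 0} = card {v \<in> V. c1 v = 0} + 1"
      using combine[of c1] by (auto simp: proper_colouring_def)
    have "c u \<noteq> c v" if "(u, v) \<in> ?E" for u v
    proof -
      from split[OF that] show ?thesis
      proof
        assume 1: "(u, v) \<in> E"
        then show ?thesis
          using ends[OF 1] c(1) c1(1) by (simp add: proper_colouring_def)
      next
        assume 2: "(u, v) \<in> ?F"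
        then show ?thesis
          using endsP[OF 2] c(3) d(2)[OF 2] by metis
      qed
    qed
    then have "proper_colouring (rel_graph ?W ?E) k c"
      using c(2) by (simp add: proper_colouring_def)
    then show ?thesis
      using c(4) c1(2) unfolding avoidable_def by (intro exI[of _ c]) simp
  qed
  moreover have "almost_colourable k ?W ?E (t + 1)"
  proof -
    obtain c1 where c1: "\<forall>v \<in> V. c1 v < k" "\<forall>(u, v) \<in> E. c1 u = c1 v \<longrightarrow> c1 u = 0"
      "card {v \<in> V. c1 v = 0} = t"
      using g unfolding gap_def almost_colourable_def by blast
    then obtain c where c: "\<forall>v \<in> V. c v = c1 v" "\<forall>v \<in> ?W. c v < k" "\<forall>v \<in> ?P. c v = ?d v"
      "card {v \<in> ?W. c v = 0} = card {v \<in> V. c1 v = 0} + 1"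
      using combine[of c1] by blast
    have "c u = 0" if "(u, v) \<in> ?E" "c u = c v" for u v
    proof -
      from split[OF that(1)] show ?thesis
      proof
        assume 1: "(u, v) \<in> E"
        then show ?thesis
          using ends[OF 1] c(1) c1(2) that(2) by auto
      next
        assume 2: "(u, v) \<in> ?F"
        then show ?thesis
          using endsP[OF 2] c(3) d(2)[OF 2] that(2) by metis
      qed
    qed
    then show ?thesis
      using c(2,4) c1(3) unfolding almost_colourable_def by (intro exI[of _ c]) auto
  qed
  moreover have "simple_on ?W ?E"
    using simple_on_join[OF sV(1) sP disj] by simp
  ultimately have "gap k ?W ?E (t + 1)"
    using need forced by (simp add: gap_def)
  moreover have degP: "card (?F `` {v}) \<le> \<Delta>" if "v \<in> ?P" for v
  proof -
    have "?F `` {v} \<subseteq> ?P - {v}"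
      using k by auto
    then have "card (?F `` {v}) \<le> card (?P - {v})"
      by (intro card_mono) auto
    then show ?thesis
      using that by simp
  qed
  have "\<forall>v \<in> ?W. card (?E `` {v}) \<le> \<Delta>"
    using degree_join_bound[OF sV(1) sP disj _ _ deg] degP by simp
  moreover have "card (?E `` {N}) = \<Delta>"
  proof -
    have "N \<notin> V"
      using disj by auto
    then have "?E `` {N} = {N + 1..N + \<Delta>}"
      using sV k unfolding join_def simple_on_def by auto
    then show ?thesis
      by simp
  qed
  ultimately show ?thesis
    by (intro exI[of _ ?W] exI[of _ ?E] exI[of _ "t + 1"]) auto
qed

section \<open>Stability numbers\<close>

lemma (in graph) card_clique_le_colours:
  assumes "is_clique G K" "proper_colouring G k c"
  shows "card K \<le> k"
proof -
  have "inj_on c K"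
  proof (rule inj_onI, rule ccontr)
    fix u v
    assume "u \<in> K" "v \<in> K" "c u = c v" "u \<noteq> v"
    moreover from this have "u \<rightarrow> v"
      using assms(1) by (simp add: is_clique_def)
    ultimately show False
      using assms(2) by (simp add: proper_colouring_def)
  qed
  moreover have "c ` K \<subseteq> {..<k}"
    using assms by (auto simp: is_clique_def proper_colouring_def)
  ultimately show ?thesis
    using card_inj_on_le[of c K "{..<k}"] by simp
qed

lemma (in graph) clique_number_le_chromatic_number: "clique_number G \<le> chromatic_number G"
proof -
  obtain K where "is_clique G K" "card K = clique_number G"
    using obtain_maximum_clique .
  moreover obtain c where "proper_colouring G (chromatic_number G) c"
    using obtain_optimal_colouring .
  ultimately show ?thesis
    using card_clique_le_colours by metis
qed

lemma chromatic_number_le: "proper_colouring G k c \<Longrightarrow> chromatic_number G \<le> k"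
  unfolding chromatic_number_def by (rule Least_le) blast

lemma verts_remove_verts: "verts (remove_verts G S) = verts G - S"
  by (simp add: remove_verts_def)

lemma dominates_remove_verts:
  "u \<rightarrow>\<^bsub>remove_verts G S\<^esub> v \<longleftrightarrow> u \<rightarrow>\<^bsub>G\<^esub> v \<and> u \<in> verts G - S \<and> v \<in> verts G - S"
  by (auto simp: remove_verts_def arcs_ends_conv)

lemma meets_cliques_if_clique_number_less:
  assumes "graph G" "clique_number (remove_verts G S) < k"
  shows "meets_cliques k G S"
  unfolding meets_cliques_def
proof (intro allI impI notI)
  fix K
  assume K: "is_clique G K" "card K = k" "S \<inter> K = {}"
  interpret R: graph "remove_verts G S"
    using assms(1) by (rule graph.graph_remove_verts)
  have "is_clique (remove_verts G S) K"
    using K(1,3) by (auto simp: is_clique_def dominates_remove_verts verts_remove_verts)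
  from R.card_clique_le[OF this] show False
    using K(2) assms(2) by simp
qed

text \<open>The remaining colours are shifted down by one.\<close>
lemma chromatic_number_remove_zero_class:
  assumes "0 < k" "\<forall>v \<in> verts G. c v < k" "\<forall>u v. u \<rightarrow>\<^bsub>G\<^esub> v \<longrightarrow> c u = c v \<longrightarrow> c u = 0"
  shows "chromatic_number (remove_verts G {v \<in> verts G. c v = 0}) < k"
proof -
  have "proper_colouring (remove_verts G {v \<in> verts G. c v = 0}) (k - 1) (\<lambda>v. c v - 1)"
    unfolding proper_colouring_def dominates_remove_verts
  proof (intro conjI ballI allI impI)
    fix v
    assume "v \<in> verts (remove_verts G {v \<in> verts G. c v = 0})"
    then have "v \<in> verts G" "c v \<noteq> 0"
      by (auto simp: remove_verts_def)
    then show "c v - 1 < k - 1"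
      using assms(2) by fastforce
  next
    fix u v
    assume "u \<rightarrow>\<^bsub>G\<^esub> v \<and> u \<in> verts G - {v \<in> verts G. c v = 0} \<and> v \<in> verts G - {v \<in> verts G. c v = 0}"
    moreover from this have "c u \<noteq> 0" "c v \<noteq> 0"
      by auto
    ultimately have "c u \<noteq> 0" "c v \<noteq> 0" "c u \<noteq> c v"
      using assms(3) by blast+
    then show "c u - 1 \<noteq> c v - 1"
      by simp
  qed
  from chromatic_number_le[OF this] show ?thesis
    using assms(1) by simp
qed

text \<open>
  Whatever lowers the chromatic number below \<open>k\<close> also lowers the clique number. A witness for the former
  and a matching lower bound for the latter therefore determine both minima.
\<close>
lemma Least_between:
  fixes P Q :: "nat \<Rightarrow> bool"
  assumes "P n" "\<And>i. P i \<Longrightarrow> Q i" "\<And>i. Q i \<Longrightarrow> n \<le> i"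
  shows "(LEAST i. P i) = n" "(LEAST i. Q i) = n"
  using assms by (auto intro!: Least_equality)

lemma stability_numbers_of_gap:
  assumes g: "gap k V E t" and "0 < t" "0 < k"
  defines "G \<equiv> rel_graph V E"
  shows "graph G" "clique_number G = k" "chromatic_number G = k"
    "vs_chromatic G = t" "vs_clique G = t" "ivs_chromatic G = Suc t" "ivs_clique G = Suc t"
proof -
  have s: "simple_on V E"
    using g by (simp add: gap_def)
  then interpret graph G
    unfolding G_def by (rule graph_rel_graph)
  show "graph G"
    by unfold_locales
  have V: "verts G = V"
    by (simp add: G_def)
  have need: "t \<le> card S" if "S \<subseteq> verts G" "clique_number (remove_verts G S) < k" for S
    using g meets_cliques_if_clique_number_less[OF \<open>graph G\<close> that(2)] that(1)
    by (simp add: gap_def cliques_need_def G_def)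
  have le: "clique_number (remove_verts G S) < k" if "chromatic_number (remove_verts G S) < k" for S
    using graph.clique_number_le_chromatic_number[OF graph_remove_verts] that by (rule le_less_trans)
  obtain c where c: "proper_colouring G k c" "card {v \<in> V. c v = 0} = Suc t"
    using g unfolding gap_def avoidable_def G_def by blast
  obtain d where d: "\<forall>v \<in> V. d v < k" "\<forall>(u, v) \<in> E. d u = d v \<longrightarrow> d u = 0"
    "card {v \<in> V. d v = 0} = t"
    using g unfolding gap_def almost_colourable_def by blast
  have "\<not> meets_cliques k G {}"
    using g \<open>0 < t\<close> by (auto simp: gap_def cliques_need_def G_def)
  then obtain K where K: "is_clique G K" "card K = k"
    unfolding meets_cliques_def by blast
  have "k \<le> clique_number G"
    using card_clique_le K by blast
  then show \<omega>: "clique_number G = k" and \<chi>: "chromatic_number G = k"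
    using clique_number_le_chromatic_number chromatic_number_le[OF c(1)] by linarith+
  have "chromatic_number (remove_verts G {v \<in> verts G. d v = 0}) < k"
    using d \<open>0 < k\<close> by (intro chromatic_number_remove_zero_class) (auto simp: G_def)
  then have d': "\<exists>S \<subseteq> verts G. card S = t \<and> chromatic_number (remove_verts G S) < k"
    using d(3) V by (intro exI[of _ "{v \<in> verts G. d v = 0}"]) auto
  let ?vs\<chi> = "\<lambda>n. \<exists>S \<subseteq> verts G. card S = n \<and> chromatic_number (remove_verts G S) < k"
  let ?vs\<omega> = "\<lambda>n. \<exists>S \<subseteq> verts G. card S = n \<and> clique_number (remove_verts G S) < k"
  have "?vs\<omega> i" if "?vs\<chi> i" for i
    using that le by blast
  moreover have "t \<le> i" if "?vs\<omega> i" for i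
    using that need by blast
  ultimately show "vs_chromatic G = t" "vs_clique G = t"
    unfolding vs_chromatic_def vs_clique_def \<omega> \<chi>
    using Least_between[of ?vs\<chi> "t" ?vs\<omega>, OF d'] by blast+
  have "chromatic_number (remove_verts G {v \<in> verts G. c v = 0}) < k"
    using c \<open>0 < k\<close> by (intro chromatic_number_remove_zero_class) (auto simp: proper_colouring_def)
  moreover have "is_independent G {v \<in> verts G. c v = 0}"
    using c(1) by (fastforce simp: is_independent_def proper_colouring_def)
  ultimately have c': "\<exists>S. is_independent G S \<and> card S = Suc t \<and>
      chromatic_number (remove_verts G S) < k"
    using c(2) V by blast
  have need': "Suc t \<le> card S"
    if "is_independent G S" "clique_number (remove_verts G S) < k" for S
  proof -
    have "S \<subseteq> verts G"
      using that(1) by (simp add: is_independent_def)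
    then have "t \<le> card S"
      using need that(2) by blast
    moreover have "card S \<noteq> t"
      using g that meets_cliques_if_clique_number_less[OF \<open>graph G\<close> that(2)]
      by (auto simp: gap_def forced_def G_def)
    ultimately show ?thesis
      by simp
  qed
  let ?ivs\<chi> = "\<lambda>n. \<exists>S. is_independent G S \<and> card S = n \<and> chromatic_number (remove_verts G S) < k"
  let ?ivs\<omega> = "\<lambda>n. \<exists>S. is_independent G S \<and> card S = n \<and> clique_number (remove_verts G S) < k"
  have "?ivs\<omega> i" if "?ivs\<chi> i" for i
    using that le by blast
  moreover have "Suc t \<le> i" if "?ivs\<omega> i" for i
    using that need' by blast
  ultimately show "ivs_chromatic G = Suc t" "ivs_clique G = Suc t"
    unfolding ivs_chromatic_def ivs_clique_def \<omega> \<chi>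
    using Least_between[of ?ivs\<chi> "Suc t" ?ivs\<omega>, OF c'] by blast+
qed

theorem proposition12:
  fixes \<Delta> :: nat
  assumes "\<Delta> \<ge> 3"
  shows "\<exists>G :: (nat, nat \<times> nat) pre_digraph. graph G \<and> max_degree G = \<Delta> \<and>
    clique_number G = chromatic_number G \<and>
    int (chromatic_number G) = \<lceil>2 / 3 * (real \<Delta> + 1)\<rceil> - 1 \<and>
    vs_chromatic G = vs_clique G \<and>
    vs_clique G < ivs_clique G \<and>
    ivs_clique G = ivs_chromatic G"
proof -
  define m where "m = \<Delta> div 3"
  \<comment> \<open>This is the largest integer below \<open>2/3 (\<Delta> + 1)\<close>.\<close>
  define k where "k = (if \<Delta> mod 3 = 0 then 2 * m else 2 * m + 1)"
  have m: "0 < m" "\<Delta> = 3 * m + \<Delta> mod 3"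
    using assms by (auto simp: m_def)
  have "\<lceil>2 / 3 * (real \<Delta> + 1)\<rceil> = int k + 1"
  proof -
    have "\<Delta> mod 3 = 0 \<or> \<Delta> mod 3 = 1 \<or> \<Delta> mod 3 = 2"
      by arith
    then have "\<Delta> = 3 * m \<and> k = 2 * m \<or> \<Delta> = 3 * m + 1 \<and> k = 2 * m + 1 \<or>
        \<Delta> = 3 * m + 2 \<and> k = 2 * m + 1"
      using m(2) unfolding k_def by presburger
    then show ?thesis
      by (elim disjE conjE) (simp_all add: ceiling_eq_iff field_simps)
  qed
  then have k: "int k = \<lceil>2 / 3 * (real \<Delta> + 1)\<rceil> - 1"
    by simp
  have "assembly k \<Delta> m (2 * m - 1)"
    using m assembly_even[of m \<Delta>] assembly_odd[of m \<Delta>] by (auto simp: k_def)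
  moreover have "2 * m \<le> k"
    by (simp add: k_def)
  ultimately have "\<exists>V E t. gap k V E t \<and> (\<forall>v \<in> V. card (E `` {v}) \<le> \<Delta>)"
    using m(1) by (intro assembly_gap[of m k \<Delta> "2 * m - 1"]) auto
  then obtain V E t where VE: "gap k V E t" "\<forall>v \<in> V. card (E `` {v}) \<le> \<Delta>"
    by blast
  have k2: "2 \<le> k" "k \<le> \<Delta> + 1"
    using m by (auto simp: k_def)
  from gap_pad[OF VE k2] obtain V' E' t' where G: "gap k V' E' t'" "0 < t'"
    "\<forall>v \<in> V'. card (E' `` {v}) \<le> \<Delta>" "\<exists>v \<in> V'. card (E' `` {v}) = \<Delta>"
    by (elim exE conjE) (rule that)
  let ?G = "rel_graph V' E'"
  have "finite V'"
    using G(1) by (simp add: gap_def simple_on_def)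
  then have "max_degree ?G = \<Delta>"
    using G(3,4) unfolding max_degree_def out_degree_rel_graph verts_rel_graph
    by (intro Max_eqI) auto
  moreover have "0 < k"
    using k2 by simp
  note stability_numbers_of_gap[OF G(1,2) this]
  ultimately show ?thesis
    using k by (intro exI[of _ ?G]) simp
qed

end
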